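(* Let $G$ be a finite group and $f:G\to\mathbb{C}$. Then $Rf=0$ if and only if $\tilde f(\rho)\in K^*(\rho)$ for all $\rho\in\hat G$, or, equivalently, $\tilde f(\rho)=0$ for all $\rho\in\hat G\setminus FPF(G)$.
   Context: For $n\ge 2$ let $C_n$ be the cyclic group of order $n$, and let $\Gamma_n$ be the set of nontrivial homomorphisms $C_n\to G$. For $f:G\to\mathbb{C}$, $x\in G$ and $\gamma\in\Gamma_n$ put $R_nf(x,\gamma)=\sum_{t\in C_n}f(x\gamma(t))$. The Radon transform is $Rf=(R_nf)_{n\ge2}$; $Rf=0$ means $R_nf=0$ for all $n\ge2$. $\hat G$ denotes a set containing exactly one representative of each equivalence class of irreducible complex representations of $G$; each $\rho\in\hat G$ is finite dimensional, has representation space $\mathbb{C}^{\dim(\rho)}$, and is taken unitary with respect to the standard inner product. The Fourier transform of $f$ is $\tilde f(\rho)=\sum_{x\in G}f(x)\rho(x)$, a $\dim(\rho)\times\dim(\rho)$ matrix, for $\rho\in\hat G$. For $\rho\in\hat G$ and $\gamma\in\Gamma_n$ let $I(\rho,\gamma)=\sum_{t\in C_n}\rho(\gamma(t))$, a linear map $\mathbb{C}^{\dim(\rho)}\to\mathbb{C}^{\dim(\rho)}$, and let $$k(\rho)=\bigcap_{p\mid |G|}\ \bigcap_{\gamma\in\Gamma_p}\ker(I(\rho,\gamma)),$$ the outer intersection being over all primes $p$ dividing $|G|$. $K^*(\rho)$ is the space of $\dim(\rho)\times\dim(\rho)$ complex matrices such that the conjugate transpose of each row belongs to $k(\rho)$.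 For a representation $\rho:G\to GL(V)$ let $F_\rho=\{v\in V:\rho(x)v=v\text{ for some }x\in G\setminus\{e\}\}$, where $e$ is the identity of $G$, and let $FPF(G)=\{\rho\in\hat G: F_\rho=\{0\}\}$.
   Formalization: FPF(G) is defined by F_ρ ⊆ {0} instead of F_ρ = {0}; this differs only for the trivial group, where F_ρ is empty and the second equivalence as written would fail (f(e)=1 has Rf=0 but nonzero transform). *)

theory Defs
  imports
    "HOL-Algebra.Elementary_Groups"
    "HOL-Computational_Algebra.Primes"
    "Jordan_Normal_Form.Schur_Decomposition"
    "Jordan_Normal_Form.Matrix_Kernel"
begin

section \<open>The Radon transform\<close>

text \<open>The cyclic group \<open>C\<^sub>n\<close> is \<^const>\<open>integer_mod_group\<close> \<open>n\<close>.\<close>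

definition nontriv_homs :: "nat \<Rightarrow> ('a, 'b) monoid_scheme \<Rightarrow> (int \<Rightarrow> 'a) set" where
  "nontriv_homs n G =
     {\<gamma> \<in> hom (integer_mod_group n) G. \<exists>t \<in> carrier (integer_mod_group n). \<gamma> t \<noteq> \<one>\<^bsub>G\<^esub>}"

definition radon :: "('a, 'b) monoid_scheme \<Rightarrow> nat \<Rightarrow> ('a \<Rightarrow> complex) \<Rightarrow> 'a \<Rightarrow> (int \<Rightarrow> 'a) \<Rightarrow> complex" where
  "radon G n f x \<gamma> = (\<Sum>t \<in> carrier (integer_mod_group n). f (x \<otimes>\<^bsub>G\<^esub> \<gamma> t))"

definition radon_zero :: "('a, 'b) monoid_scheme \<Rightarrow> ('a \<Rightarrow> complex) \<Rightarrow> bool" where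
  "radon_zero G f \<longleftrightarrow>
     (\<forall>n \<ge> 2. \<forall>x \<in> carrier G. \<forall>\<gamma> \<in> nontriv_homs n G. radon G n f x \<gamma> = 0)"

section \<open>Matrix representations\<close>

abbreviation cmat_ring :: "nat \<Rightarrow> complex mat ring" where
  "cmat_ring n \<equiv> ring_mat TYPE(complex) n ()"

abbreviation GL :: "nat \<Rightarrow> complex mat monoid" where
  "GL n \<equiv> units_of (cmat_ring n)"

text \<open>A representation is a bare function into matrices; its dimension is recovered from the
  size of the matrix assigned to the identity.\<close>

definition rep_dim :: "('a, 'b) monoid_scheme \<Rightarrow> ('a \<Rightarrow> complex mat) \<Rightarrow> nat" where
  "rep_dim G \<rho> = dim_row (\<rho> \<one>\<^bsub>G\<^esub>)"

definition representation :: "('a, 'b) monoid_scheme \<Rightarrow> ('a \<Rightarrow> complex mat) \<Rightarrow> bool" where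
  "representation G \<rho> \<longleftrightarrow> \<rho> \<in> hom G (GL (rep_dim G \<rho>))"

definition irreducible_rep :: "('a, 'b) monoid_scheme \<Rightarrow> ('a \<Rightarrow> complex mat) \<Rightarrow> bool" where
  "irreducible_rep G \<rho> \<longleftrightarrow>
     representation G \<rho> \<and> rep_dim G \<rho> > 0 \<and>
     (\<forall>W. VectorSpace.subspace class_ring W (module_vec TYPE(complex) (rep_dim G \<rho>)) \<and>
          (\<forall>x \<in> carrier G. \<forall>w \<in> W. \<rho> x *\<^sub>v w \<in> W) \<longrightarrow>
          W = {0\<^sub>v (rep_dim G \<rho>)} \<or> W = carrier_vec (rep_dim G \<rho>))"

definition equivalent_reps ::
  "('a, 'b) monoid_scheme \<Rightarrow> ('a \<Rightarrow> complex mat) \<Rightarrow> ('a \<Rightarrow> complex mat) \<Rightarrow> bool" where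
  "equivalent_reps G \<rho> \<sigma> \<longleftrightarrow>
     rep_dim G \<rho> = rep_dim G \<sigma> \<and>
     (\<exists>P \<in> carrier (GL (rep_dim G \<rho>)). \<forall>x \<in> carrier G. P * \<rho> x = \<sigma> x * P)"

definition unitary_rep :: "('a, 'b) monoid_scheme \<Rightarrow> ('a \<Rightarrow> complex mat) \<Rightarrow> bool" where
  "unitary_rep G \<rho> \<longleftrightarrow>
     representation G \<rho> \<and> (\<forall>x \<in> carrier G. mat_adjoint (\<rho> x) * \<rho> x = 1\<^sub>m (rep_dim G \<rho>))"

text \<open>The dual of \<open>G\<close> is only determined up to the choice of representatives, so it is a
  parameter \<open>Ghat\<close> subject to the following predicate. The classes range over all irreducible
  representations \<open>\<sigma>\<close>, unitary or not.\<close>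

definition is_dual :: "('a, 'b) monoid_scheme \<Rightarrow> ('a \<Rightarrow> complex mat) set \<Rightarrow> bool" where
  "is_dual G Ghat \<longleftrightarrow>
     (\<forall>\<rho> \<in> Ghat. irreducible_rep G \<rho> \<and> unitary_rep G \<rho>) \<and>
     (\<forall>\<sigma>. irreducible_rep G \<sigma> \<longrightarrow> (\<exists>!\<rho>. \<rho> \<in> Ghat \<and> equivalent_reps G \<rho> \<sigma>))"

section \<open>Fourier transform and the spaces attached to a representation\<close>

definition fourier ::
  "('a, 'b) monoid_scheme \<Rightarrow> ('a \<Rightarrow> complex) \<Rightarrow> ('a \<Rightarrow> complex mat) \<Rightarrow> complex mat" where
  "fourier G f \<rho> = (\<Oplus>\<^bsub>cmat_ring (rep_dim G \<rho>)\<^esub> x \<in> carrier G. f x \<cdot>\<^sub>m \<rho> x)"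

definition I_op ::
  "('a, 'b) monoid_scheme \<Rightarrow> nat \<Rightarrow> ('a \<Rightarrow> complex mat) \<Rightarrow> (int \<Rightarrow> 'a) \<Rightarrow> complex mat" where
  "I_op G n \<rho> \<gamma> =
     (\<Oplus>\<^bsub>cmat_ring (rep_dim G \<rho>)\<^esub> t \<in> carrier (integer_mod_group n). \<rho> (\<gamma> t))"

text \<open>Intersecting with \<^const>\<open>carrier_vec\<close> makes the empty intersection (trivial \<open>G\<close>) the whole
  representation space.\<close>

definition k_space :: "('a, 'b) monoid_scheme \<Rightarrow> ('a \<Rightarrow> complex mat) \<Rightarrow> complex vec set" where
  "k_space G \<rho> = carrier_vec (rep_dim G \<rho>) \<inter>
     (\<Inter>p \<in> {p::nat. Factorial_Ring.prime p \<and> p dvd Coset.order G}. \<Inter>\<gamma> \<in> nontriv_homs p G. mat_kernel (I_op G p \<rho> \<gamma>))"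

text \<open>Vectors carry no row/column distinction, so the conjugate transpose of a row is its
  entrywise conjugate.\<close>

definition K_star :: "('a, 'b) monoid_scheme \<Rightarrow> ('a \<Rightarrow> complex mat) \<Rightarrow> complex mat set" where
  "K_star G \<rho> = {M \<in> carrier_mat (rep_dim G \<rho>) (rep_dim G \<rho>).
     \<forall>i < rep_dim G \<rho>. conjugate (row M i) \<in> k_space G \<rho>}"

definition F_set :: "('a, 'b) monoid_scheme \<Rightarrow> ('a \<Rightarrow> complex mat) \<Rightarrow> complex vec set" where
  "F_set G \<rho> = {v \<in> carrier_vec (rep_dim G \<rho>). \<exists>x \<in> carrier G - {\<one>\<^bsub>G\<^esub>}. \<rho> x *\<^sub>v v = v}"

text \<open>If \<open>G\<close> is nontrivial then \<open>0 \<in> F_set G \<rho>\<close> and the inclusion below is an equality. If \<open>G\<close>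
  is trivial then \<open>F_set G \<rho>\<close> is empty, and its representation counts as fixed point free.\<close>

definition FPF ::
  "('a, 'b) monoid_scheme \<Rightarrow> ('a \<Rightarrow> complex mat) set \<Rightarrow> ('a \<Rightarrow> complex mat) set" where
  "FPF G Ghat = {\<rho> \<in> Ghat. F_set G \<rho> \<subseteq> {0\<^sub>v (rep_dim G \<rho>)}}"

end

theory Submission
  imports Defs "HOL-Algebra.Multiplicative_Group"
begin

text \<open>
  Two facts about a finite group carry the proof.

  First, the Fourier transform is injective: if \<open>f\<close> has vanishing transform at every irreducible
  representation, then \<open>f = 0\<close> on the group. An irreducible representation is equivalent to some
  member of the dual, so vanishing on the dual means vanishing at all of them. By strong induction
  on the dimension (lemma \<open>fourier_zero_unitary\<close>) the transform then vanishes at every unitary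
  representation: a reducible one splits as an orthogonal direct sum of two smaller unitary ones
  (lemma \<open>unitary_rep_split\<close>). The regular representation is unitary, and the matrix of \<open>f\<close> there
  has the values of \<open>f\<close> as its entries.

  Second, for a homomorphism \<open>\<gamma>\<close> from a cyclic group, the function \<open>x \<mapsto> R\<^sub>n f(x, \<gamma>)\<close> is a convolution
  of \<open>f\<close>, so its Fourier transform at \<open>\<rho>\<close> is \<open>f\<close>'s transform times \<open>I(\<rho>, \<gamma>)\<close> (lemma
  \<open>fourier_radon\<close>). By injectivity \<open>R\<^sub>n f(\<sqdot>, \<gamma>) = 0\<close> holds exactly when all these products vanish.
  For unitary \<open>\<rho>\<close> the matrix \<open>I(\<rho>, \<gamma>)\<close> is Hermitian, so a product \<open>M I(\<rho>, \<gamma>)\<close> vanishes exactly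
  when the conjugate transposes of the rows of \<open>M\<close> lie in the kernel of \<open>I(\<rho>, \<gamma>)\<close>. This gives the
  first equivalence, once the homomorphisms are reduced to those from groups of prime order
  (lemma \<open>radon_zero_prime\<close>): the image of a nontrivial \<open>\<gamma>\<close> contains a subgroup of prime order, and a
  sum over the image is a sum of sums over cosets of that subgroup.

  For the second equivalence, \<open>k(\<rho>)\<close> is an invariant subspace, because conjugation permutes the
  homomorphisms; for irreducible \<open>\<rho>\<close> it is therefore zero or the whole space. It is the whole space
  exactly for the fixed point free representations, since up to a scalar \<open>I(\<rho>, \<gamma>)\<close> is the projection
  onto the vectors fixed by the image of \<open>\<gamma>\<close>. So \<open>K\<^sup>*(\<rho>)\<close> consists of all matrices if \<open>\<rho>\<close> is fixed
  point free and of the zero matrix alone if not.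
\<close>

section \<open>Adjoints and sums of matrices\<close>

lemma adjoint_dims [simp]:
  "dim_row (mat_adjoint A) = dim_col A" "dim_col (mat_adjoint A) = dim_row A"
  by (auto simp: mat_adjoint_def)
lemma adjoint_carrier [simp, intro]:
  "A \<in> carrier_mat n m \<Longrightarrow> mat_adjoint A \<in> carrier_mat m n"
  by (metis carrier_matD carrier_matI adjoint_dims)
lemma adjoint_index [simp]:
  "i < dim_col A \<Longrightarrow> j < dim_row A \<Longrightarrow> mat_adjoint A $$ (i, j) = conjugate (A $$ (j, i))"
  by (simp add: mat_adjoint_def mat_of_rows_index)

lemma adjoint_mult:
  fixes A B :: "complex mat"
  assumes "A \<in> carrier_mat n m" "B \<in> carrier_mat m k"
  shows "mat_adjoint (A * B) = mat_adjoint B * mat_adjoint A"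
  using assms
  by (intro eq_matI) (auto simp: scalar_prod_def sum_conjugate conjugate_dist_mul mult.commute)

lemma adjoint_adjoint [simp]: "mat_adjoint (mat_adjoint A) = A"
  by (intro eq_matI) auto

text \<open>
  Matrix addition is no \<open>comm_monoid_add\<close>, as the dimension is not part of the type. Summing entry
  by entry keeps the theory of \<^const>\<open>sum\<close> applicable, and allows rectangular matrices, which occur
  as intertwiners.
\<close>

definition mat_sum :: "nat \<Rightarrow> nat \<Rightarrow> ('x \<Rightarrow> complex mat) \<Rightarrow> 'x set \<Rightarrow> complex mat" where
  "mat_sum n m M S = mat n m (\<lambda>(i, j). \<Sum>x\<in>S. M x $$ (i, j))"

lemma mat_sum_carrier [simp, intro]: "mat_sum n m M S \<in> carrier_mat n m"
  and mat_sum_dims [simp]: "dim_row (mat_sum n m M S) = n" "dim_col (mat_sum n m M S) = m"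
  and mat_sum_index [simp]:
    "i < n \<Longrightarrow> j < m \<Longrightarrow> mat_sum n m M S $$ (i, j) = (\<Sum>x\<in>S. M x $$ (i, j))"
  by (auto simp: mat_sum_def)

lemma finsum_eq_mat_sum:
  assumes "finite S" "\<And>x. x \<in> S \<Longrightarrow> M x \<in> carrier_mat n n"
  shows "(\<Oplus>\<^bsub>cmat_ring n\<^esub> x \<in> S. M x) = mat_sum n n M S"
  using assms
proof (induction S rule: finite_induct)
  interpret ring "cmat_ring n" by (rule ring_mat)
  case empty
  then show ?case by (auto simp: ring_mat_simps mat_sum_def)
next
  interpret ring "cmat_ring n" by (rule ring_mat)
  case (insert x S)
  have "(\<Oplus>\<^bsub>cmat_ring n\<^esub> y \<in> insert x S. M y) = M x + (\<Oplus>\<^bsub>cmat_ring n\<^esub> y \<in> S. M y)"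
    using insert by (subst finsum_insert) (auto simp: ring_mat_simps)
  also have "\<dots> = M x + mat_sum n n M S" using insert by auto
  also have "\<dots> = mat_sum n n M (insert x S)"
    using insert by (intro eq_matI) auto
  finally show ?case .
qed

lemma mat_sum_cong:
  assumes "\<And>x. x \<in> S \<Longrightarrow> M x = N x"
  shows "mat_sum n m M S = mat_sum n m N S"
  using assms by (auto simp: mat_sum_def intro!: eq_matI)

lemma mult_mat_sum:
  assumes "A \<in> carrier_mat n m" "\<And>x. x \<in> S \<Longrightarrow> M x \<in> carrier_mat m k"
  shows "A * mat_sum m k M S = mat_sum n k (\<lambda>x. A * M x) S"
proof (intro eq_matI)
  fix i j assume "i < dim_row (mat_sum n k (\<lambda>x. A * M x) S)" "j < dim_col (mat_sum n k (\<lambda>x. A * M x) S)"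
  then have ij: "i < n" "j < k" by auto
  have M: "dim_row (M x) = m" "dim_col (M x) = k" if "x \<in> S" for x
    using assms(2)[OF that] by auto
  have "(A * mat_sum m k M S) $$ (i, j) = (\<Sum>l<m. A $$ (i, l) * (\<Sum>x\<in>S. M x $$ (l, j)))"
    using ij assms(1) by (auto simp: scalar_prod_def atLeast0LessThan)
  also have "\<dots> = (\<Sum>x\<in>S. \<Sum>l<m. A $$ (i, l) * M x $$ (l, j))"
    unfolding sum_distrib_left by (rule sum.swap)
  also have "\<dots> = (\<Sum>x\<in>S. (A * M x) $$ (i, j))"
    using ij assms(1) by (intro sum.cong) (simp_all add: scalar_prod_def atLeast0LessThan M)
  finally show "(A * mat_sum m k M S) $$ (i, j) = mat_sum n k (\<lambda>x. A * M x) S $$ (i, j)"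
    using ij by simp
qed (use assms in auto)

lemma mat_sum_mult:
  assumes "A \<in> carrier_mat m k" "\<And>x. x \<in> S \<Longrightarrow> M x \<in> carrier_mat n m"
  shows "mat_sum n m M S * A = mat_sum n k (\<lambda>x. M x * A) S"
proof (intro eq_matI)
  fix i j assume "i < dim_row (mat_sum n k (\<lambda>x. M x * A) S)" "j < dim_col (mat_sum n k (\<lambda>x. M x * A) S)"
  then have ij: "i < n" "j < k" by auto
  have M: "dim_row (M x) = n" "dim_col (M x) = m" if "x \<in> S" for x
    using assms(2)[OF that] by auto
  have "(mat_sum n m M S * A) $$ (i, j) = (\<Sum>l<m. (\<Sum>x\<in>S. M x $$ (i, l)) * A $$ (l, j))"
    using ij assms(1) by (auto simp: scalar_prod_def atLeast0LessThan)
  also have "\<dots> = (\<Sum>x\<in>S. \<Sum>l<m. M x $$ (i, l) * A $$ (l, j))"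
    unfolding sum_distrib_right by (rule sum.swap)
  also have "\<dots> = (\<Sum>x\<in>S. (M x * A) $$ (i, j))"
    using ij assms(1) by (intro sum.cong) (simp_all add: scalar_prod_def atLeast0LessThan M)
  finally show "(mat_sum n m M S * A) $$ (i, j) = mat_sum n k (\<lambda>x. M x * A) S $$ (i, j)"
    using ij by simp
qed (use assms in auto)

lemma mat_sum_mult_vec_index:
  assumes "v \<in> carrier_vec m" "\<And>x. x \<in> S \<Longrightarrow> M x \<in> carrier_mat n m" "i < n"
  shows "(mat_sum n m M S *\<^sub>v v) $ i = (\<Sum>x\<in>S. (M x *\<^sub>v v) $ i)"
proof -
  have M: "dim_row (M x) = n" "dim_col (M x) = m" if "x \<in> S" for x
    using assms(2)[OF that] by auto
  have "(mat_sum n m M S *\<^sub>v v) $ i = (\<Sum>l<m. (\<Sum>x\<in>S. M x $$ (i, l)) * v $ l)"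
    using assms by (auto simp: scalar_prod_def atLeast0LessThan)
  also have "\<dots> = (\<Sum>x\<in>S. \<Sum>l<m. M x $$ (i, l) * v $ l)"
    unfolding sum_distrib_right by (rule sum.swap)
  also have "\<dots> = (\<Sum>x\<in>S. (M x *\<^sub>v v) $ i)"
    using assms(1,3) by (intro sum.cong) (simp_all add: scalar_prod_def atLeast0LessThan M)
  finally show ?thesis .
qed

lemma mat_sum_reindex:
  assumes "bij_betw h S T"
  shows "mat_sum n m (\<lambda>x. M (h x)) S = mat_sum n m M T"
proof -
  have "(\<Sum>x\<in>S. M (h x) $$ ij) = (\<Sum>x\<in>T. M x $$ ij)" for ij
    by (rule sum.reindex_bij_betw[OF assms])
  then show ?thesis by (simp add: mat_sum_def)
qed

lemma mult_mat_assoc: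
  fixes A B C :: "complex mat"
  assumes "dim_col A = dim_row B" "dim_col B = dim_row C"
  shows "A * B * C = A * (B * C)"
  using assms by (intro assoc_mult_mat) auto

section \<open>Isometries onto subspaces\<close>

lemma subspace_iff:
  "VectorSpace.subspace class_ring W (module_vec TYPE(complex) n) \<longleftrightarrow>
     W \<subseteq> carrier_vec n \<and> 0\<^sub>v n \<in> W \<and> (\<forall>v\<in>W. \<forall>w\<in>W. v + w \<in> W) \<and> (\<forall>c. \<forall>v\<in>W. c \<cdot>\<^sub>v v \<in> W)"
proof -
  interpret vec_space "TYPE(complex)" n .
  show ?thesis
    unfolding VectorSpace.subspace_def submodule_def
    using vectorspace_axioms module_axioms by (auto simp: module_vec_simps)
qed

lemma subspace_minus:
  assumes "VectorSpace.subspace class_ring W (module_vec TYPE(complex) n)" "v \<in> W" "w \<in> W"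
  shows "v - w \<in> W"
proof -
  have "v - w = v + (-1) \<cdot>\<^sub>v w"
    using assms by (intro eq_vecI) (auto simp: subspace_iff)
  then show ?thesis using assms unfolding subspace_iff by metis
qed

lemma subspace_mult_mat_vec:
  assumes W: "VectorSpace.subspace class_ring W (module_vec TYPE(complex) n)"
    and B: "B \<in> carrier_mat n k" "\<And>j. j < k \<Longrightarrow> col B j \<in> W" and c: "c \<in> carrier_vec k"
  shows "B *\<^sub>v c \<in> W"
proof -
  have "m \<le> k \<Longrightarrow> vec n (\<lambda>i. \<Sum>j<m. B $$ (i, j) * c $ j) \<in> W" for m
  proof (induction m)
    case 0
    have "vec n (\<lambda>i. \<Sum>j<0. B $$ (i, j) * c $ j) = 0\<^sub>v n" by (intro eq_vecI) auto
    then show ?case using W by (auto simp: subspace_iff)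
  next
    case (Suc m)
    have "vec n (\<lambda>i. \<Sum>j<Suc m. B $$ (i, j) * c $ j) =
        vec n (\<lambda>i. \<Sum>j<m. B $$ (i, j) * c $ j) + c $ m \<cdot>\<^sub>v col B m"
      using Suc.prems B(1) by (intro eq_vecI) (auto simp: ac_simps)
    moreover have "c $ m \<cdot>\<^sub>v col B m \<in> W" using W B(2) Suc.prems by (auto simp: subspace_iff)
    ultimately show ?case using W Suc by (auto simp: subspace_iff)
  qed
  moreover have "B *\<^sub>v c = vec n (\<lambda>i. \<Sum>j<k. B $$ (i, j) * c $ j)"
    using B(1) c by (intro eq_vecI) (auto simp: scalar_prod_def atLeast0LessThan)
  ultimately show ?thesis by auto
qed

text \<open>
  The columns of such a matrix are an orthonormal list, so orthonormal bases and the projections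
  \<open>B B\<^sup>*\<close> can be handled by matrix algebra alone.
\<close>

definition isometry :: "nat \<Rightarrow> nat \<Rightarrow> complex mat \<Rightarrow> bool" where
  "isometry n k B \<longleftrightarrow> B \<in> carrier_mat n k \<and> mat_adjoint B * B = 1\<^sub>m k"

lemma adjoint_mult_index:
  assumes "B \<in> carrier_mat n k" "C \<in> carrier_mat n m" "i < k" "j < m"
  shows "(mat_adjoint B * C) $$ (i, j) = (\<Sum>l<n. cnj (B $$ (l, i)) * C $$ (l, j))"
  using assms by (simp add: scalar_prod_def atLeast0LessThan)

lemma mult_adjoint_diag:
  assumes "B \<in> carrier_mat n k" "i < n"
  shows "(B * mat_adjoint B) $$ (i, i) = of_real (\<Sum>j<k. (cmod (B $$ (i, j)))\<^sup>2)"
proof -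
  have "(B * mat_adjoint B) $$ (i, i) = (\<Sum>j<k. B $$ (i, j) * cnj (B $$ (i, j)))"
    using assms by (simp add: scalar_prod_def atLeast0LessThan)
  also have "\<dots> = of_real (\<Sum>j<k. (cmod (B $$ (i, j)))\<^sup>2)"
    by (simp only: of_real_sum complex_norm_square)
  finally show ?thesis .
qed

text \<open>
  This computes the trace of \<open>B\<^sup>* B\<close>. Read row by row, the left-hand side is the trace of \<open>B B\<^sup>*\<close>;
  it takes the place of a dimension formula below.
\<close>

lemma isometry_norm_sum:
  assumes "isometry n k B"
  shows "(\<Sum>i<n. \<Sum>j<k. (cmod (B $$ (i, j)))\<^sup>2) = real k"
proof -
  have B: "B \<in> carrier_mat n k" "mat_adjoint B * B = 1\<^sub>m k" using assms by (auto simp: isometry_def)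
  have "(\<Sum>i<n. (cmod (B $$ (i, j)))\<^sup>2) = 1" if "j < k" for j
  proof -
    have "of_real (\<Sum>i<n. (cmod (B $$ (i, j)))\<^sup>2) = (mat_adjoint B * B) $$ (j, j)"
      unfolding adjoint_mult_index[OF B(1) B(1) that that] of_real_sum
      by (simp only: complex_norm_square mult.commute)
    also have "\<dots> = of_real 1" using B that by simp
    finally show ?thesis unfolding of_real_eq_iff .
  qed
  then have "(\<Sum>j<k. \<Sum>i<n. (cmod (B $$ (i, j)))\<^sup>2) = (\<Sum>j<k. 1)" by (intro sum.cong) auto
  then show ?thesis by (subst sum.swap) simp
qed

text \<open>
  The projection \<open>P = B B\<^sup>*\<close> is idempotent and Hermitian, so each diagonal entry \<open>r\<close> is the sum
  of the squared moduli of its row and satisfies \<open>r\<^sup>2 \<le> r\<close>, hence \<open>r \<le> 1\<close>. Summing the diagonal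
  gives \<open>k \<le> n\<close>.
\<close>

lemma isometry_dim_le:
  assumes "isometry n k B"
  shows "k \<le> n"
proof -
  have B: "B \<in> carrier_mat n k" "mat_adjoint B * B = 1\<^sub>m k" using assms by (auto simp: isometry_def)
  note Ba = adjoint_carrier[OF B(1)]
  define P where "P = B * mat_adjoint B"
  have P: "P \<in> carrier_mat n n" using B unfolding P_def by auto
  have adj: "mat_adjoint P = P"
    unfolding P_def by (simp add: adjoint_mult[OF B(1) adjoint_carrier[OF B(1)]])
  have "P * mat_adjoint P = B * (mat_adjoint B * B) * mat_adjoint B"
    unfolding adj unfolding P_def
    using assoc_mult_mat[OF B(1) Ba P] assoc_mult_mat[OF Ba B(1) Ba]
      assoc_mult_mat[OF B(1) mult_carrier_mat[OF Ba B(1)] Ba] by (simp add: P_def)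
  then have idem: "P * mat_adjoint P = P" using B unfolding P_def by simp
  have row: "(\<Sum>j<k. (cmod (B $$ (i, j)))\<^sup>2) \<le> 1" if i: "i < n" for i
  proof -
    define r where "r = (\<Sum>j<k. (cmod (B $$ (i, j)))\<^sup>2)"
    have Pii: "P $$ (i, i) = of_real r" unfolding P_def r_def by (rule mult_adjoint_diag[OF B(1) i])
    have "complex_of_real r = of_real (\<Sum>j<n. (cmod (P $$ (i, j)))\<^sup>2)"
      using mult_adjoint_diag[OF P i] unfolding idem Pii by simp
    then have "r = (\<Sum>j<n. (cmod (P $$ (i, j)))\<^sup>2)" unfolding of_real_eq_iff .
    also have "\<dots> \<ge> (cmod (P $$ (i, i)))\<^sup>2" using i by (intro member_le_sum) auto
    finally have "r\<^sup>2 \<le> r" unfolding Pii by simp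
    moreover have "r * 1 < r * r" if "1 < r" using that by (intro mult_strict_left_mono) auto
    ultimately show ?thesis unfolding r_def[symmetric] by (simp add: power2_eq_square not_le[symmetric]) (meson not_le)
  qed
  have "real k = (\<Sum>i<n. \<Sum>j<k. (cmod (B $$ (i, j)))\<^sup>2)" using isometry_norm_sum[OF assms] by simp
  also have "\<dots> \<le> (\<Sum>i<n. 1)" using row by (intro sum_mono) auto
  finally show ?thesis by simp
qed

lemma isometry_extend:
  assumes B: "isometry n k B" and u: "u \<in> carrier_vec n"
    and orth: "mat_adjoint B *\<^sub>v u = 0\<^sub>v k" and unit: "(\<Sum>l<n. (cmod (u $ l))\<^sup>2) = 1"
  shows "isometry n (Suc k) (mat n (Suc k) (\<lambda>(i, j). if j < k then B $$ (i, j) else u $ i))"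
    (is "isometry n _ ?B")
proof -
  have Bc: "B \<in> carrier_mat n k" "mat_adjoint B * B = 1\<^sub>m k" using B by (auto simp: isometry_def)
  have C: "?B \<in> carrier_mat n (Suc k)" by simp
  have old: "(\<Sum>l<n. cnj (B $$ (l, i)) * B $$ (l, j)) = (if i = j then 1 else 0)"
    if "i < k" "j < k" for i j
    using adjoint_mult_index[OF Bc(1) Bc(1) that] Bc(2) that by simp
  have mixed: "(\<Sum>l<n. cnj (B $$ (l, i)) * u $ l) = 0" if "i < k" for i
  proof -
    have "(mat_adjoint B *\<^sub>v u) $ i = (\<Sum>l<n. cnj (B $$ (l, i)) * u $ l)"
      using Bc u that by (simp add: scalar_prod_def atLeast0LessThan)
    then show ?thesis using orth that by simp
  qed
  have mixed': "(\<Sum>l<n. cnj (u $ l) * B $$ (l, i)) = 0" if "i < k" for i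
    using arg_cong[OF mixed[OF that], of cnj] by (simp add: cnj_sum mult.commute)
  have new: "(\<Sum>l<n. cnj (u $ l) * u $ l) = 1"
  proof -
    have "(\<Sum>l<n. cnj (u $ l) * u $ l) = of_real (\<Sum>l<n. (cmod (u $ l))\<^sup>2)"
      unfolding of_real_sum by (simp only: complex_norm_square mult.commute)
    then show ?thesis using unit by simp
  qed
  have "mat_adjoint ?B * ?B = 1\<^sub>m (Suc k)"
  proof (intro eq_matI)
    fix i j assume "i < dim_row (1\<^sub>m (Suc k) :: complex mat)" "j < dim_col (1\<^sub>m (Suc k) :: complex mat)"
    then have ij: "i < Suc k" "j < Suc k" by auto
    then show "(mat_adjoint ?B * ?B) $$ (i, j) = 1\<^sub>m (Suc k) $$ (i, j)"
      unfolding adjoint_mult_index[OF C C ij]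
      using old mixed mixed' new by (cases "i < k"; cases "j < k") (auto simp: less_Suc_eq)
  qed simp_all
  then show ?thesis by (simp add: isometry_def)
qed

text \<open>
  Every subspace has an orthonormal basis: take an isometry with columns in \<open>W\<close> whose number of
  columns is maximal. A vector of \<open>W\<close> with nonzero residual \<open>w - B B\<^sup>* w\<close> would, after
  normalisation, supply one more column.
\<close>

lemma subspace_isometry:
  assumes W: "VectorSpace.subspace class_ring W (module_vec TYPE(complex) n)"
  obtains k B where "isometry n k B" "\<forall>j<k. col B j \<in> W"
    "\<forall>w\<in>W. B *\<^sub>v (mat_adjoint B *\<^sub>v w) = w"
proof -
  define Q where "Q k \<longleftrightarrow> (\<exists>B. isometry n k B \<and> (\<forall>j<k. col B j \<in> W))" for k
  have "isometry n 0 (0\<^sub>m n 0)" unfolding isometry_def by (auto intro!: eq_matI)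
  then have "Q 0" unfolding Q_def by auto
  moreover have bound: "k \<le> n" if "Q k" for k using that isometry_dim_le unfolding Q_def by blast
  ultimately obtain k where k: "Q k" "\<And>m. Q m \<Longrightarrow> m \<le> k"
    by (metis GreatestI_nat Greatest_le_nat)
  from k(1) obtain B where B: "isometry n k B" and cols: "\<And>j. j < k \<Longrightarrow> col B j \<in> W"
    unfolding Q_def by auto
  have Bc: "B \<in> carrier_mat n k" "mat_adjoint B * B = 1\<^sub>m k" using B by (auto simp: isometry_def)
  note Ba = adjoint_carrier[OF Bc(1)]
  have "B *\<^sub>v (mat_adjoint B *\<^sub>v w) = w" if w: "w \<in> W" for w
  proof (rule ccontr)
    assume neq: "B *\<^sub>v (mat_adjoint B *\<^sub>v w) \<noteq> w"
    have wc: "w \<in> carrier_vec n" using W w by (auto simp: subspace_iff)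
    define p where "p = B *\<^sub>v (mat_adjoint B *\<^sub>v w)"
    define r where "r = w - p"
    have c: "mat_adjoint B *\<^sub>v w \<in> carrier_vec k" using Ba wc by auto
    have p: "p \<in> W" "p \<in> carrier_vec n"
      using subspace_mult_mat_vec[OF W Bc(1) cols c] Bc(1) c unfolding p_def by auto
    have r: "r \<in> W" "r \<in> carrier_vec n"
      unfolding r_def using subspace_minus[OF W w p(1)] p(2) wc by auto
    have "mat_adjoint B *\<^sub>v p = mat_adjoint B *\<^sub>v w"
      unfolding p_def using assoc_mult_mat_vec[OF Ba Bc(1) c] Bc(2) c by simp
    then have Br: "mat_adjoint B *\<^sub>v r = 0\<^sub>v k"
      unfolding r_def using mult_minus_distrib_mat_vec[OF Ba wc p(2)] c by simp
    define s where "s = sqrt (\<Sum>l<n. (cmod (r $ l))\<^sup>2)"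
    have s0: "s \<noteq> 0"
    proof
      assume "s = 0"
      then have "\<forall>l<n. r $ l = 0" unfolding s_def by (simp add: sum_nonneg_eq_0_iff)
      then have "w = p" using p(2) wc unfolding r_def by (intro eq_vecI) auto
      then show False using neq p_def by simp
    qed
    define u where "u = complex_of_real (1 / s) \<cdot>\<^sub>v r"
    have u: "u \<in> W" "u \<in> carrier_vec n" using r W unfolding u_def by (auto simp: subspace_iff)
    have Bu: "mat_adjoint B *\<^sub>v u = 0\<^sub>v k"
      unfolding u_def using mult_mat_vec[OF Ba r(2)] Br by auto
    have "(\<Sum>l<n. (cmod (u $ l))\<^sup>2) = (\<Sum>l<n. (cmod (r $ l))\<^sup>2 / s\<^sup>2)"
      using r(2) unfolding u_def
      by (intro sum.cong) (auto simp: norm_mult norm_divide power_mult_distrib power_divide)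
    also have "\<dots> = s\<^sup>2 / s\<^sup>2"
      unfolding s_def by (simp add: sum_divide_distrib[symmetric] sum_nonneg)
    also have "\<dots> = 1" using s0 by simp
    finally have unit: "(\<Sum>l<n. (cmod (u $ l))\<^sup>2) = 1" .
    define B' where "B' = mat n (Suc k) (\<lambda>(i, j). if j < k then B $$ (i, j) else u $ i)"
    have "isometry n (Suc k) B'" unfolding B'_def by (rule isometry_extend[OF B u(2) Bu unit])
    moreover have "col B' j \<in> W" if "j < Suc k" for j
    proof -
      have "col B' j = (if j < k then col B j else u)"
        using that Bc(1) u(2) unfolding B'_def by (intro eq_vecI) auto
      then show ?thesis using cols u(1) by auto
    qed
    ultimately have "Q (Suc k)" unfolding Q_def by blast
    then show False using k(2) by fastforce
  qed
  then show ?thesis using that B cols by blast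
qed

lemma isometry_fix_cols:
  assumes "isometry n k B" "\<And>w. w \<in> W \<Longrightarrow> B *\<^sub>v (mat_adjoint B *\<^sub>v w) = w"
    and M: "M \<in> carrier_mat n m" "\<And>j. j < m \<Longrightarrow> col M j \<in> W"
  shows "B * (mat_adjoint B * M) = M"
proof (rule mat_col_eqI)
  have B: "B \<in> carrier_mat n k" using assms by (auto simp: isometry_def)
  fix j assume "j < dim_col M"
  then have j: "j < m" using M by auto
  have "col (B * (mat_adjoint B * M)) j = B *\<^sub>v (mat_adjoint B *\<^sub>v col M j)"
    using col_mult2[OF B mult_carrier_mat[OF adjoint_carrier[OF B] M(1)] j]
      col_mult2[OF adjoint_carrier[OF B] M(1) j] by simp
  then show "col (B * (mat_adjoint B * M)) j = col M j" using assms(2) M(2) j by simp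
qed (use assms in \<open>auto simp: isometry_def\<close>)

lemma adjoint_kernel_subspace:
  assumes "B \<in> carrier_mat n k"
  shows "VectorSpace.subspace class_ring {v \<in> carrier_vec n. mat_adjoint B *\<^sub>v v = 0\<^sub>v k}
    (module_vec TYPE(complex) n)"
proof -
  have "mat_adjoint B *\<^sub>v 0\<^sub>v n = 0\<^sub>v k" using assms by (intro eq_vecI) auto
  then show ?thesis using adjoint_carrier[OF assms]
    by (auto simp: subspace_iff mult_add_distrib_mat_vec mult_mat_vec)
qed

text \<open>
  An isometry \<open>C\<close> onto the orthogonal complement of the range of \<open>B\<close>. Every column of
  \<open>R = 1 - B B\<^sup>*\<close> lies in the complement, so \<open>C C\<^sup>* R = R\<close>; as \<open>C\<^sup>* B = 0\<close> this says
  \<open>C C\<^sup>* = R\<close>. Comparing traces in \<open>B B\<^sup>* + C C\<^sup>* = 1\<close> gives \<open>k + l = n\<close>.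
\<close>

lemma orthogonal_isometry:
  assumes B: "isometry n k B"
  obtains l C where "isometry n l C" "\<forall>j<l. mat_adjoint B *\<^sub>v col C j = 0\<^sub>v k"
    "\<forall>M m. M \<in> carrier_mat n m \<longrightarrow> mat_adjoint B * M = 0\<^sub>m k m \<longrightarrow> C * (mat_adjoint C * M) = M"
    "B * mat_adjoint B + C * mat_adjoint C = 1\<^sub>m n" "k + l = n"
proof -
  have Bc: "B \<in> carrier_mat n k" "mat_adjoint B * B = 1\<^sub>m k" using B by (auto simp: isometry_def)
  note Ba = adjoint_carrier[OF Bc(1)]
  let ?V = "{v \<in> carrier_vec n. mat_adjoint B *\<^sub>v v = 0\<^sub>v k}"
  obtain l C where C: "isometry n l C" and cols: "\<forall>j<l. col C j \<in> ?V"
    and Cf: "\<forall>v\<in>?V. C *\<^sub>v (mat_adjoint C *\<^sub>v v) = v"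
    by (rule subspace_isometry[OF adjoint_kernel_subspace[OF Bc(1)]])
  have Cc: "C \<in> carrier_mat n l" "mat_adjoint C * C = 1\<^sub>m l" using C by (auto simp: isometry_def)
  note Ca = adjoint_carrier[OF Cc(1)]
  have fixM: "C * (mat_adjoint C * M) = M" if M: "M \<in> carrier_mat n m" "mat_adjoint B * M = 0\<^sub>m k m" for M m
  proof (rule isometry_fix_cols[OF C Cf[rule_format] M(1)])
    fix j assume j: "j < m"
    have "mat_adjoint B *\<^sub>v col M j = col (mat_adjoint B * M) j"
      using col_mult2[OF Ba M(1) j] by simp
    also have "\<dots> = 0\<^sub>v k" using M(2) j by simp
    finally show "col M j \<in> ?V" using M(1) by auto
  qed auto
  have BC: "mat_adjoint B * C = 0\<^sub>m k l"
  proof (rule mat_col_eqI)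
    fix j assume "j < dim_col (0\<^sub>m k l :: complex mat)"
    then have j: "j < l" by simp
    then show "col (mat_adjoint B * C) j = col (0\<^sub>m k l) j"
      using col_mult2[OF Ba Cc(1) j] cols j by simp
  qed (use Bc Cc in auto)
  have "mat_adjoint (mat_adjoint B * C) = 0\<^sub>m l k" unfolding BC by (intro eq_matI) auto
  then have CB: "mat_adjoint C * B = 0\<^sub>m l k" using adjoint_mult[OF Ba Cc(1)] by simp
  define P where "P = B * mat_adjoint B"
  have P: "P \<in> carrier_mat n n" unfolding P_def using Bc Ba by auto
  define R where "R = 1\<^sub>m n - P"
  have R: "R \<in> carrier_mat n n" unfolding R_def using P by (intro minus_carrier_mat)
  have "mat_adjoint B * P = mat_adjoint B"
    unfolding P_def using Bc Ba by (simp add: mult_mat_assoc[symmetric])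
  then have "mat_adjoint B * R = 0\<^sub>m k n"
    unfolding R_def using mult_minus_distrib_mat[OF Ba one_carrier_mat P] Ba
    by (simp add: right_mult_one_mat[OF Ba] minus_r_inv_mat)
  from fixM[OF R this] have "C * (mat_adjoint C * R) = R" .
  moreover have "mat_adjoint C * P = 0\<^sub>m l n"
    unfolding P_def using Bc Cc CB Ba by (simp add: mult_mat_assoc[symmetric])
  then have "mat_adjoint C * R = mat_adjoint C"
    unfolding R_def using mult_minus_distrib_mat[OF Ca one_carrier_mat P] Ca Cc
    by (simp add: right_mult_one_mat[OF Ca]) (intro eq_matI, auto)
  ultimately have CR: "C * mat_adjoint C = R" by simp
  have sum: "B * mat_adjoint B + C * mat_adjoint C = 1\<^sub>m n"
    unfolding CR R_def P_def using P unfolding P_def by (intro eq_matI) auto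
  have "(\<Sum>j<k. (cmod (B $$ (i, j)))\<^sup>2) + (\<Sum>j<l. (cmod (C $$ (i, j)))\<^sup>2) = 1" if i: "i < n" for i
  proof -
    have "(B * mat_adjoint B + C * mat_adjoint C) $$ (i, i) =
      (B * mat_adjoint B) $$ (i, i) + (C * mat_adjoint C) $$ (i, i)"
      using Bc Cc i by simp
    then have "complex_of_real ((\<Sum>j<k. (cmod (B $$ (i, j)))\<^sup>2) + (\<Sum>j<l. (cmod (C $$ (i, j)))\<^sup>2)) = of_real 1"
      using mult_adjoint_diag[OF Bc(1) i] mult_adjoint_diag[OF Cc(1) i] i unfolding sum by simp
    then show ?thesis unfolding of_real_eq_iff .
  qed
  then have "(\<Sum>i<n. (\<Sum>j<k. (cmod (B $$ (i, j)))\<^sup>2) + (\<Sum>j<l. (cmod (C $$ (i, j)))\<^sup>2)) = (\<Sum>i<n. 1)"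
    by (intro sum.cong) auto
  then have "real k + real l = real n"
    unfolding sum.distrib isometry_norm_sum[OF B] isometry_norm_sum[OF C] by simp
  then have "k + l = n" by linarith
  show ?thesis
  proof (rule that[OF C _ _ sum \<open>k + l = n\<close>])
    show "\<forall>j<l. mat_adjoint B *\<^sub>v col C j = 0\<^sub>v k" using cols by simp
    show "\<forall>M m. M \<in> carrier_mat n m \<longrightarrow> mat_adjoint B * M = 0\<^sub>m k m \<longrightarrow> C * (mat_adjoint C * M) = M"
      using fixM by blast
  qed
qed

section \<open>Unitary representations and orthogonal splitting\<close>

context group
begin

lemma rep_carrier:
  assumes "representation G \<rho>" "x \<in> carrier G"
  shows "\<rho> x \<in> carrier_mat (rep_dim G \<rho>) (rep_dim G \<rho>)"
  using hom_in_carrier[of \<rho> G "GL (rep_dim G \<rho>)" x] assms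
  by (auto simp: representation_def units_of_def Units_def ring_mat_simps)

lemma rep_dims [simp]:
  assumes "representation G \<rho>" "x \<in> carrier G"
  shows "dim_row (\<rho> x) = rep_dim G \<rho>" "dim_col (\<rho> x) = rep_dim G \<rho>"
  using rep_carrier[OF assms] by auto

lemma rep_mult:
  assumes "representation G \<rho>" "x \<in> carrier G" "y \<in> carrier G"
  shows "\<rho> (x \<otimes> y) = \<rho> x * \<rho> y"
  using assms by (auto simp: representation_def hom_def units_of_def ring_mat_simps)

lemma rep_one:
  assumes "representation G \<rho>"
  shows "\<rho> \<one> = 1\<^sub>m (rep_dim G \<rho>)"
proof -
  interpret R: ring "cmat_ring (rep_dim G \<rho>)" by (rule ring_mat)
  have "group (GL (rep_dim G \<rho>))" by (rule R.units_group)
  then have "\<rho> \<one> = \<one>\<^bsub>GL (rep_dim G \<rho>)\<^esub>"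
    using assms is_group unfolding representation_def by (intro hom_one)
  then show ?thesis by (simp add: units_of_def ring_mat_simps)
qed

lemma representationI:
  assumes c: "\<And>x. x \<in> carrier G \<Longrightarrow> \<rho> x \<in> carrier_mat n n"
    and m: "\<And>x y. x \<in> carrier G \<Longrightarrow> y \<in> carrier G \<Longrightarrow> \<rho> (x \<otimes> y) = \<rho> x * \<rho> y"
    and o: "\<rho> \<one> = 1\<^sub>m n"
  shows "representation G \<rho>" "rep_dim G \<rho> = n"
proof -
  show d: "rep_dim G \<rho> = n" using o by (simp add: rep_dim_def)
  have "\<rho> x \<in> Units (cmat_ring n)" if x: "x \<in> carrier G" for x
  proof -
    have "\<rho> (inv x) * \<rho> x = 1\<^sub>m n" "\<rho> x * \<rho> (inv x) = 1\<^sub>m n"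
      using m[of "inv x" x] m[of x "inv x"] x o by auto
    then show ?thesis using c[OF x] c[OF inv_closed[OF x]] by (auto simp: Units_def ring_mat_simps)
  qed
  then show "representation G \<rho>"
    unfolding representation_def d using m by (auto simp: hom_def units_of_def ring_mat_simps)
qed

lemma unitary_rep_adjoint:
  assumes "unitary_rep G \<rho>" "x \<in> carrier G"
  shows "mat_adjoint (\<rho> x) = \<rho> (inv x)"
proof -
  have r: "representation G \<rho>" and u: "mat_adjoint (\<rho> x) * \<rho> x = 1\<^sub>m (rep_dim G \<rho>)"
    using assms by (auto simp: unitary_rep_def)
  have "mat_adjoint (\<rho> x) * (\<rho> x * \<rho> (inv x)) = \<rho> (inv x)"
    using u r assms(2) rep_carrier[OF r inv_closed[OF assms(2)]]
    by (subst mult_mat_assoc[symmetric]) auto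
  moreover have "\<rho> x * \<rho> (inv x) = 1\<^sub>m (rep_dim G \<rho>)"
    using rep_mult[OF r assms(2) inv_closed[OF assms(2)]] rep_one[OF r] assms(2) by simp
  ultimately show ?thesis
    using right_mult_one_mat[OF adjoint_carrier[OF rep_carrier[OF r assms(2)]]] by simp
qed

lemma fourier_eq_mat_sum:
  assumes "finite (carrier G)" "representation G \<rho>"
  shows "fourier G f \<rho> = mat_sum (rep_dim G \<rho>) (rep_dim G \<rho>) (\<lambda>x. f x \<cdot>\<^sub>m \<rho> x) (carrier G)"
  unfolding fourier_def using assms rep_carrier by (intro finsum_eq_mat_sum) auto

lemma fourier_intertwine:
  assumes "finite (carrier G)" "representation G \<rho>" "representation G \<sigma>"
    and B: "B \<in> carrier_mat (rep_dim G \<rho>) (rep_dim G \<sigma>)"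
    and eq: "\<And>x. x \<in> carrier G \<Longrightarrow> \<rho> x * B = B * \<sigma> x"
  shows "fourier G f \<rho> * B = B * fourier G f \<sigma>"
proof -
  let ?n = "rep_dim G \<rho>" and ?k = "rep_dim G \<sigma>"
  have "fourier G f \<rho> * B = mat_sum ?n ?k (\<lambda>x. f x \<cdot>\<^sub>m \<rho> x * B) (carrier G)"
    unfolding fourier_eq_mat_sum[OF assms(1,2)]
    using rep_carrier[OF assms(2)] by (intro mat_sum_mult[OF B]) auto
  also have "\<dots> = mat_sum ?n ?k (\<lambda>x. B * (f x \<cdot>\<^sub>m \<sigma> x)) (carrier G)"
    using mult_smult_assoc_mat[OF rep_carrier[OF assms(2)] B]
      mult_smult_distrib[OF B rep_carrier[OF assms(3)]] eq
    by (intro mat_sum_cong) simp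
  also have "\<dots> = B * fourier G f \<sigma>"
    unfolding fourier_eq_mat_sum[OF assms(1,3)]
    using rep_carrier[OF assms(3)] by (intro mult_mat_sum[OF B, symmetric]) auto
  finally show ?thesis .
qed

text \<open>
  The restriction of \<open>\<rho>\<close> to an invariant subspace, written in an orthonormal basis. The hypothesis
  on \<open>B B\<^sup>* \<rho>(x) B\<close> expresses invariance of the range of \<open>B\<close>.
\<close>

lemma compression:
  assumes u: "unitary_rep G \<rho>" and B: "isometry (rep_dim G \<rho>) k B"
    and inv: "\<And>x. x \<in> carrier G \<Longrightarrow> B * (mat_adjoint B * (\<rho> x * B)) = \<rho> x * B"
  defines "\<sigma> \<equiv> \<lambda>x. mat_adjoint B * (\<rho> x * B)"
  shows "unitary_rep G \<sigma>" "rep_dim G \<sigma> = k" "\<And>x. x \<in> carrier G \<Longrightarrow> \<rho> x * B = B * \<sigma> x"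
proof -
  have r: "representation G \<rho>" and un: "\<And>x. x \<in> carrier G \<Longrightarrow> mat_adjoint (\<rho> x) * \<rho> x = 1\<^sub>m (rep_dim G \<rho>)"
    using u by (auto simp: unitary_rep_def)
  have Bc: "B \<in> carrier_mat (rep_dim G \<rho>) k" "mat_adjoint B * B = 1\<^sub>m k"
    using B by (auto simp: isometry_def)
  have Bd: "dim_row B = rep_dim G \<rho>" "dim_col B = k" using Bc by auto
  have c: "\<sigma> x \<in> carrier_mat k k" if "x \<in> carrier G" for x
    unfolding \<sigma>_def using rep_carrier[OF r that] adjoint_carrier[OF Bc(1)] Bc(1) by auto
  have m: "\<sigma> (x \<otimes> y) = \<sigma> x * \<sigma> y" if xy: "x \<in> carrier G" "y \<in> carrier G" for x y
  proof -
    have "\<sigma> x * \<sigma> y = mat_adjoint B * (\<rho> x * (B * (mat_adjoint B * (\<rho> y * B))))"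
      unfolding \<sigma>_def using r xy Bd by (simp add: mult_mat_assoc)
    also have "\<dots> = \<sigma> (x \<otimes> y)"
      unfolding \<sigma>_def inv[OF xy(2)] using r xy Bd by (simp add: mult_mat_assoc rep_mult)
    finally show ?thesis ..
  qed
  have o: "\<sigma> \<one> = 1\<^sub>m k"
    unfolding \<sigma>_def rep_one[OF r] using Bc by simp
  show d: "rep_dim G \<sigma> = k" by (rule representationI(2)[of \<sigma> k, OF c m o])
  have "mat_adjoint (\<sigma> x) * \<sigma> x = 1\<^sub>m k" if x: "x \<in> carrier G" for x
  proof -
    have "mat_adjoint (\<sigma> x) = mat_adjoint (\<rho> x * B) * B"
      unfolding \<sigma>_def using adjoint_mult[OF adjoint_carrier[OF Bc(1)], of "\<rho> x * B" k]
        rep_carrier[OF r x] Bc(1) by auto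
    also have "\<dots> = mat_adjoint B * (mat_adjoint (\<rho> x) * B)"
      using adjoint_mult[OF rep_carrier[OF r x] Bc(1)] r x Bd by (simp add: mult_mat_assoc)
    finally have "mat_adjoint (\<sigma> x) * \<sigma> x =
        mat_adjoint B * (mat_adjoint (\<rho> x) * (B * (mat_adjoint B * (\<rho> x * B))))"
      unfolding \<sigma>_def using r x Bd by (simp add: mult_mat_assoc)
    also have "\<dots> = mat_adjoint B * (mat_adjoint (\<rho> x) * \<rho> x * B)"
      unfolding inv[OF x] using r x Bd by (simp add: mult_mat_assoc)
    also have "\<dots> = 1\<^sub>m k" unfolding un[OF x] using Bc by simp
    finally show ?thesis .
  qed
  then show "unitary_rep G \<sigma>"
    unfolding unitary_rep_def d using representationI(1)[of \<sigma> k, OF c m o] by auto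
  show "\<rho> x * B = B * \<sigma> x" if "x \<in> carrier G" for x
    unfolding \<sigma>_def using inv[OF that] by simp
qed

text \<open>
  An invariant subspace and its orthogonal complement, which is invariant because \<open>\<rho>\<close> is unitary.
  Both are proper and nonzero, so both dimensions drop.
\<close>

lemma unitary_rep_split:
  assumes u: "unitary_rep G \<rho>" and pos: "rep_dim G \<rho> > 0" and "\<not> irreducible_rep G \<rho>"
  obtains k l B C \<sigma> \<tau> where "B \<in> carrier_mat (rep_dim G \<rho>) k" "C \<in> carrier_mat (rep_dim G \<rho>) l"
    "B * mat_adjoint B + C * mat_adjoint C = 1\<^sub>m (rep_dim G \<rho>)"
    "unitary_rep G \<sigma>" "rep_dim G \<sigma> = k" "\<forall>x\<in>carrier G. \<rho> x * B = B * \<sigma> x"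
    "unitary_rep G \<tau>" "rep_dim G \<tau> = l" "\<forall>x\<in>carrier G. \<rho> x * C = C * \<tau> x"
    "k < rep_dim G \<rho>" "l < rep_dim G \<rho>"
proof -
  let ?n = "rep_dim G \<rho>"
  have r: "representation G \<rho>" using u by (simp add: unitary_rep_def)
  obtain W where W: "VectorSpace.subspace class_ring W (module_vec TYPE(complex) ?n)"
    and stable: "\<And>x w. x \<in> carrier G \<Longrightarrow> w \<in> W \<Longrightarrow> \<rho> x *\<^sub>v w \<in> W"
    and ne: "W \<noteq> {0\<^sub>v ?n}" "W \<noteq> carrier_vec ?n"
  proof -
    have "\<not> (\<forall>W. VectorSpace.subspace class_ring W (module_vec TYPE(complex) ?n) \<and>
        (\<forall>x \<in> carrier G. \<forall>w \<in> W. \<rho> x *\<^sub>v w \<in> W) \<longrightarrow> W = {0\<^sub>v ?n} \<or> W = carrier_vec ?n)"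
      using assms(3) r pos unfolding irreducible_rep_def by blast
    then show thesis using that by blast
  qed
  obtain k B where B: "isometry ?n k B" and Bcols: "\<forall>j<k. col B j \<in> W"
    and Bfix: "\<forall>w\<in>W. B *\<^sub>v (mat_adjoint B *\<^sub>v w) = w"
    by (rule subspace_isometry[OF W])
  obtain l C where C: "isometry ?n l C" and Ccols: "\<forall>j<l. mat_adjoint B *\<^sub>v col C j = 0\<^sub>v k"
    and Cfix: "\<forall>M m. M \<in> carrier_mat ?n m \<longrightarrow> mat_adjoint B * M = 0\<^sub>m k m \<longrightarrow> C * (mat_adjoint C * M) = M"
    and sum: "B * mat_adjoint B + C * mat_adjoint C = 1\<^sub>m ?n" and dim: "k + l = ?n"
    by (rule orthogonal_isometry[OF B])
  have Bc: "B \<in> carrier_mat ?n k" and Cc: "C \<in> carrier_mat ?n l" using B C by (auto simp: isometry_def)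
  note Ba = adjoint_carrier[OF Bc]
  have Binv: "B * (mat_adjoint B * (\<rho> x * B)) = \<rho> x * B" if x: "x \<in> carrier G" for x
  proof (rule isometry_fix_cols[OF B Bfix[rule_format]])
    show "\<rho> x * B \<in> carrier_mat ?n k" using rep_carrier[OF r x] Bc by auto
    show "col (\<rho> x * B) j \<in> W" if "j < k" for j
      using col_mult2[OF rep_carrier[OF r x] Bc that] stable[OF x] Bcols that by simp
  qed
  have BC: "mat_adjoint B * C = 0\<^sub>m k l"
    by (rule mat_col_eqI) (use Bc Cc col_mult2[OF Ba Cc] Ccols in auto)
  have Cinv: "C * (mat_adjoint C * (\<rho> x * C)) = \<rho> x * C" if x: "x \<in> carrier G" for x
  proof (rule Cfix[rule_format])
    show "\<rho> x * C \<in> carrier_mat ?n l" using rep_carrier[OF r x] Cc by auto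
    let ?y = "inv x"
    have y: "?y \<in> carrier G" using x by simp
    define S where "S = mat_adjoint B * (\<rho> ?y * B)"
    have S: "S \<in> carrier_mat k k" unfolding S_def using rep_carrier[OF r y] Bc Ba by auto
    \<comment> \<open>The adjoint of \<open>\<rho>(x)\<close> is \<open>\<rho>(y)\<close>, which preserves the range of \<open>B\<close>.\<close>
    have "mat_adjoint B * \<rho> x = mat_adjoint (\<rho> ?y * B)"
      using adjoint_mult[OF rep_carrier[OF r y] Bc] unitary_rep_adjoint[OF u y] x by simp
    also have "\<dots> = mat_adjoint S * mat_adjoint B"
      using adjoint_mult[OF Bc S] Binv[OF y] by (simp add: S_def)
    finally have "mat_adjoint B * \<rho> x * C = mat_adjoint S * (mat_adjoint B * C)"
      using S Bc Cc by (simp add: mult_mat_assoc)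
    also have "\<dots> = 0\<^sub>m k l" unfolding BC using right_mult_zero_mat[OF adjoint_carrier[OF S]] by simp
    finally show "mat_adjoint B * (\<rho> x * C) = 0\<^sub>m k l"
      using r x Bc Cc by (simp add: mult_mat_assoc)
  qed
  have "k \<noteq> 0"
  proof
    assume "k = 0"
    have "w = 0\<^sub>v ?n" if "w \<in> W" for w
    proof -
      have "B *\<^sub>v (mat_adjoint B *\<^sub>v w) = 0\<^sub>v ?n"
        using Bc \<open>k = 0\<close> by (intro eq_vecI) (auto simp: scalar_prod_def)
      then show ?thesis using Bfix that by simp
    qed
    then show False using ne(1) W by (auto simp: subspace_iff)
  qed
  moreover have "l \<noteq> 0"
  proof
    assume "l = 0"
    then have "C * mat_adjoint C = 0\<^sub>m ?n ?n"
      using Cc by (intro eq_matI) (auto simp: scalar_prod_def)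
    then have one: "B * mat_adjoint B = 1\<^sub>m ?n" using sum Bc Ba by simp
    have "v \<in> W" if v: "v \<in> carrier_vec ?n" for v
    proof -
      have c: "mat_adjoint B *\<^sub>v v \<in> carrier_vec k" using Ba v by auto
      have "B *\<^sub>v (mat_adjoint B *\<^sub>v v) \<in> W" by (rule subspace_mult_mat_vec[OF W Bc Bcols[rule_format] c])
      then show ?thesis using assoc_mult_mat_vec[OF Bc Ba v] one v by simp
    qed
    then show False using ne(2) W by (auto simp: subspace_iff)
  qed
  ultimately have "k < ?n" "l < ?n" using dim by auto
  then show ?thesis
    using compression(1,2)[OF u B Binv] compression(1,2)[OF u C Cinv]
    by (intro that[OF Bc Cc sum] ballI) (assumption | erule Binv[symmetric] Cinv[symmetric])+
qed

text \<open>
  In the splitting \<open>1 = B B\<^sup>* + C C\<^sup>*\<close> the transform of \<open>f\<close> at \<open>\<rho>\<close> carries \<open>B\<close> to \<open>B\<close> times the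
  transform at the smaller representation, which vanishes by induction; likewise for \<open>C\<close>.
\<close>

lemma fourier_zero_unitary:
  assumes fin: "finite (carrier G)"
    and irr: "\<And>\<sigma>. irreducible_rep G \<sigma> \<Longrightarrow> fourier G f \<sigma> = 0\<^sub>m (rep_dim G \<sigma>) (rep_dim G \<sigma>)"
    and "unitary_rep G \<rho>"
  shows "fourier G f \<rho> = 0\<^sub>m (rep_dim G \<rho>) (rep_dim G \<rho>)"
  using assms(3)
proof (induction "rep_dim G \<rho>" arbitrary: \<rho> rule: less_induct)
  case (less \<rho>)
  let ?n = "rep_dim G \<rho>"
  have r: "representation G \<rho>" using less.prems by (simp add: unitary_rep_def)
  have F: "fourier G f \<rho> \<in> carrier_mat ?n ?n" unfolding fourier_eq_mat_sum[OF fin r] by simp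
  consider "?n = 0" | "irreducible_rep G \<rho>" | "?n > 0" "\<not> irreducible_rep G \<rho>" by auto
  then show ?case
  proof cases
    case 1
    then show ?thesis using F by (intro eq_matI) auto
  next
    case 2
    then show ?thesis by (rule irr)
  next
    case 3
    obtain k l B C \<sigma> \<tau> where B: "B \<in> carrier_mat ?n k" and C: "C \<in> carrier_mat ?n l"
      and sum: "B * mat_adjoint B + C * mat_adjoint C = 1\<^sub>m ?n"
      and s: "unitary_rep G \<sigma>" "rep_dim G \<sigma> = k" "\<forall>x\<in>carrier G. \<rho> x * B = B * \<sigma> x"
      and t: "unitary_rep G \<tau>" "rep_dim G \<tau> = l" "\<forall>x\<in>carrier G. \<rho> x * C = C * \<tau> x"
      and lt: "k < ?n" "l < ?n"
      by (rule unitary_rep_split[OF less.prems 3])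
    have zero: "fourier G f \<rho> * A = 0\<^sub>m ?n (rep_dim G \<upsilon>)"
      if "A \<in> carrier_mat ?n (rep_dim G \<upsilon>)" "unitary_rep G \<upsilon>" "rep_dim G \<upsilon> < ?n"
        "\<And>x. x \<in> carrier G \<Longrightarrow> \<rho> x * A = A * \<upsilon> x" for A \<upsilon>
      using fourier_intertwine[OF fin r _ that(1,4), of f] less.hyps[OF that(3,2)] that(1,2)
      by (simp add: unitary_rep_def)
    have FB: "fourier G f \<rho> * B = 0\<^sub>m ?n k" and FC: "fourier G f \<rho> * C = 0\<^sub>m ?n l"
      using zero[of B \<sigma>] zero[of C \<tau>] B C s t lt by auto
    have "fourier G f \<rho> = fourier G f \<rho> * (B * mat_adjoint B + C * mat_adjoint C)"
      unfolding sum using F by simp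
    also have "\<dots> = fourier G f \<rho> * (B * mat_adjoint B) + fourier G f \<rho> * (C * mat_adjoint C)"
      using mult_add_distrib_mat[OF F mult_carrier_mat[OF B adjoint_carrier[OF B]]
          mult_carrier_mat[OF C adjoint_carrier[OF C]]] .
    also have "\<dots> = 0\<^sub>m ?n ?n"
      using assoc_mult_mat[OF F B adjoint_carrier[OF B], symmetric]
        assoc_mult_mat[OF F C adjoint_carrier[OF C], symmetric]
        left_mult_zero_mat[OF adjoint_carrier[OF B]] left_mult_zero_mat[OF adjoint_carrier[OF C]] FB FC
      by simp
    finally show ?thesis .
  qed
qed

section \<open>Injectivity of the Fourier transform\<close>

text \<open>
  The left regular representation by permutation matrices, for an enumeration \<open>g\<close> of the group.
\<close>

lemma regular_unitary_rep:
  assumes fin: "finite (carrier G)" and g: "bij_betw g {..<N} (carrier G)"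
  defines "R \<equiv> \<lambda>x. mat N N (\<lambda>(i, j). if g i = x \<otimes> g j then 1 else 0 :: complex)"
  shows "unitary_rep G R" "rep_dim G R = N"
proof -
  have gc: "g i \<in> carrier G" if "i < N" for i using bij_betwE[OF g] that by auto
  have ginj: "g i = g j \<longleftrightarrow> i = j" if "i < N" "j < N" for i j
    using bij_betw_imp_inj_on[OF g] that by (auto dest: inj_onD)
  have c: "R x \<in> carrier_mat N N" for x unfolding R_def by simp
  have m: "R (x \<otimes> y) = R x * R y" if xy: "x \<in> carrier G" "y \<in> carrier G" for x y
  proof (rule eq_matI)
    fix i j assume "i < dim_row (R x * R y)" "j < dim_col (R x * R y)"
    then have ij: "i < N" "j < N" using c[of x] c[of y] by auto
    have "(R x * R y) $$ (i, j) =
        (\<Sum>l<N. (if g i = x \<otimes> g l then 1 else 0) * (if g l = y \<otimes> g j then 1 else 0))"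
      using ij unfolding R_def by (simp add: scalar_prod_def atLeast0LessThan)
    also have "\<dots> = (\<Sum>z\<in>carrier G. (if g i = x \<otimes> z then 1 else 0) * (if z = y \<otimes> g j then 1 else 0))"
      by (rule sum.reindex_bij_betw[OF g])
    also have "\<dots> = (\<Sum>z\<in>carrier G. if z = y \<otimes> g j then (if g i = x \<otimes> z then 1 else 0) else 0)"
      by (intro sum.cong) auto
    also have "\<dots> = R (x \<otimes> y) $$ (i, j)"
      using ij xy gc fin unfolding R_def by (simp add: m_assoc)
    finally show "R (x \<otimes> y) $$ (i, j) = (R x * R y) $$ (i, j)" by simp
  qed (simp_all add: R_def)
  have o: "R \<one> = 1\<^sub>m N"
    unfolding R_def by (intro eq_matI) (auto simp: gc ginj)
  show d: "rep_dim G R = N" by (rule representationI(2)[of R N, OF c m o])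
  have "mat_adjoint (R x) * R x = 1\<^sub>m N" if x: "x \<in> carrier G" for x
  proof (rule eq_matI)
    fix i j assume "i < dim_row (1\<^sub>m N :: complex mat)" "j < dim_col (1\<^sub>m N :: complex mat)"
    then have ij: "i < N" "j < N" by auto
    have "(mat_adjoint (R x) * R x) $$ (i, j) =
        (\<Sum>l<N. (if g l = x \<otimes> g i then 1 else 0) * (if g l = x \<otimes> g j then 1 else 0))"
      unfolding adjoint_mult_index[OF c c ij] using ij unfolding R_def by (intro sum.cong) auto
    also have "\<dots> = (\<Sum>z\<in>carrier G. (if z = x \<otimes> g i then 1 else 0) * (if z = x \<otimes> g j then 1 else 0))"
      by (rule sum.reindex_bij_betw[OF g])
    also have "\<dots> = (\<Sum>z\<in>carrier G. if z = x \<otimes> g i then (if z = x \<otimes> g j then 1 else 0) else 0)"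
      by (intro sum.cong) auto
    also have "\<dots> = 1\<^sub>m N $$ (i, j)"
      using ij x gc fin ginj by simp
    finally show "(mat_adjoint (R x) * R x) $$ (i, j) = 1\<^sub>m N $$ (i, j)" .
  qed (simp_all add: R_def)
  then show "unitary_rep G R"
    unfolding unitary_rep_def d using representationI(1)[of R N, OF c m o] by auto
qed

lemma fourier_injective:
  assumes fin: "finite (carrier G)"
    and irr: "\<And>\<sigma>. irreducible_rep G \<sigma> \<Longrightarrow> fourier G f \<sigma> = 0\<^sub>m (rep_dim G \<sigma>) (rep_dim G \<sigma>)"
    and y: "y \<in> carrier G"
  shows "f y = 0"
proof -
  obtain g where g: "bij_betw g {..<card (carrier G)} (carrier G)"
    using ex_bij_betw_nat_finite[OF fin] by (auto simp: atLeast0LessThan)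
  define N where "N = card (carrier G)"
  define R where "R = (\<lambda>x. mat N N (\<lambda>(i, j). if g i = x \<otimes> g j then 1 else 0 :: complex))"
  have R: "unitary_rep G R" "rep_dim G R = N"
    using regular_unitary_rep[OF fin g] unfolding R_def N_def by auto
  obtain i where i: "i < N" "g i = y"
    using y bij_betw_imp_surj_on[OF g] unfolding N_def by (metis imageE lessThan_iff)
  obtain j where j: "j < N" "g j = \<one>"
    using one_closed bij_betw_imp_surj_on[OF g] unfolding N_def by (metis imageE lessThan_iff)
  \<comment> \<open>The column of the identity lists the values of \<open>f\<close>.\<close>
  have "fourier G f R $$ (i, j) = (\<Sum>x\<in>carrier G. (f x \<cdot>\<^sub>m R x) $$ (i, j))"
    using fourier_eq_mat_sum[OF fin, of R f] R i j by (simp add: unitary_rep_def)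
  also have "\<dots> = (\<Sum>x\<in>carrier G. if x = y then f x else 0)"
    using i j unfolding R_def by (intro sum.cong) auto
  also have "\<dots> = f y" using y fin by simp
  finally show ?thesis
    using fourier_zero_unitary[OF fin irr R(1)] R(2) i j by simp
qed

text \<open>
  Vanishing of the transform depends only on the equivalence class: an invertible intertwiner \<open>P\<close>
  from \<open>\<rho>\<close> to \<open>\<sigma>\<close> turns one transform into the other.
\<close>

lemma fourier_injective_dual:
  assumes fin: "finite (carrier G)" and dual: "is_dual G Ghat"
    and zero: "\<And>\<rho>. \<rho> \<in> Ghat \<Longrightarrow> fourier G f \<rho> = 0\<^sub>m (rep_dim G \<rho>) (rep_dim G \<rho>)"
    and y: "y \<in> carrier G"
  shows "f y = 0"
proof (rule fourier_injective[OF fin _ y])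
  fix \<sigma> assume s: "irreducible_rep G \<sigma>"
  then obtain \<rho> where r: "\<rho> \<in> Ghat" and eq: "equivalent_reps G \<rho> \<sigma>"
    using dual unfolding is_dual_def by blast
  let ?n = "rep_dim G \<sigma>"
  have n: "rep_dim G \<rho> = ?n" using eq by (simp add: equivalent_reps_def)
  obtain P where P: "P \<in> carrier (GL ?n)" and int: "\<And>x. x \<in> carrier G \<Longrightarrow> \<sigma> x * P = P * \<rho> x"
    using eq n unfolding equivalent_reps_def by metis
  obtain Q where Q: "P \<in> carrier_mat ?n ?n" "Q \<in> carrier_mat ?n ?n" "P * Q = 1\<^sub>m ?n"
    using P by (auto simp: units_of_def Units_def ring_mat_simps)
  have reps: "representation G \<sigma>" "representation G \<rho>"
    using s r dual by (auto simp: irreducible_rep_def is_dual_def)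
  have F: "fourier G f \<sigma> \<in> carrier_mat ?n ?n" unfolding fourier_eq_mat_sum[OF fin reps(1)] by simp
  have "fourier G f \<sigma> * P = P * fourier G f \<rho>"
    using Q n int by (intro fourier_intertwine[OF fin reps]) auto
  also have "\<dots> = 0\<^sub>m ?n ?n" using zero[OF r] Q(1) n by simp
  finally have FP: "fourier G f \<sigma> * P = 0\<^sub>m ?n ?n" .
  have "fourier G f \<sigma> = fourier G f \<sigma> * (P * Q)" using F Q by simp
  also have "\<dots> = fourier G f \<sigma> * P * Q" using assoc_mult_mat[OF F Q(1,2)] by simp
  also have "\<dots> = 0\<^sub>m ?n ?n" unfolding FP using Q by simp
  finally show "fourier G f \<sigma> = 0\<^sub>m ?n ?n" .
qed

section \<open>The Radon transform as a convolution\<close>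

lemma right_mult_bij:
  assumes "a \<in> carrier G"
  shows "bij_betw (\<lambda>x. x \<otimes> a) (carrier G) (carrier G)"
  using assms by (intro bij_betw_byWitness[where f' = "\<lambda>x. x \<otimes> inv a"]) (auto simp: m_assoc)

lemma left_mult_bij:
  assumes "a \<in> carrier G"
  shows "bij_betw (\<lambda>x. a \<otimes> x) (carrier G) (carrier G)"
  using assms
  by (intro bij_betw_byWitness[where f' = "\<lambda>x. inv a \<otimes> x"]) (auto simp: m_assoc[symmetric])

lemma inv_bij: "bij_betw (\<lambda>x. inv x) (carrier G) (carrier G)"
  by (intro bij_betw_byWitness[where f' = "\<lambda>x. inv x"]) auto

lemma nontriv_hom_closed:
  assumes "\<gamma> \<in> nontriv_homs n G" "t \<in> carrier (integer_mod_group n)"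
  shows "\<gamma> t \<in> carrier G"
  using assms by (auto simp: nontriv_homs_def hom_def)

lemma nontriv_hom_mult:
  assumes "\<gamma> \<in> nontriv_homs n G" "s \<in> carrier (integer_mod_group n)" "t \<in> carrier (integer_mod_group n)"
  shows "\<gamma> (s \<otimes>\<^bsub>integer_mod_group n\<^esub> t) = \<gamma> s \<otimes> \<gamma> t"
  using assms by (auto simp: nontriv_homs_def hom_def)

lemma nontriv_hom_inv:
  assumes "\<gamma> \<in> nontriv_homs n G" "t \<in> carrier (integer_mod_group n)"
  shows "\<gamma> (inv\<^bsub>integer_mod_group n\<^esub> t) = inv (\<gamma> t)"
proof -
  have "group_hom (integer_mod_group n) G \<gamma>"
    using assms(1) is_group by (auto simp: group_hom_def group_hom_axioms_def nontriv_homs_def)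
  then show ?thesis using group_hom.hom_inv assms(2) by metis
qed

lemma I_op_eq_mat_sum:
  assumes "representation G \<rho>" "\<gamma> \<in> nontriv_homs n G" "n > 0"
  shows "I_op G n \<rho> \<gamma> = mat_sum (rep_dim G \<rho>) (rep_dim G \<rho>) (\<lambda>t. \<rho> (\<gamma> t)) (carrier (integer_mod_group n))"
  unfolding I_op_def using assms rep_carrier nontriv_hom_closed
  by (intro finsum_eq_mat_sum) (auto simp: carrier_integer_mod_group)

lemma I_op_carrier:
  assumes "representation G \<rho>" "\<gamma> \<in> nontriv_homs n G" "n > 0"
  shows "I_op G n \<rho> \<gamma> \<in> carrier_mat (rep_dim G \<rho>) (rep_dim G \<rho>)"
  unfolding I_op_eq_mat_sum[OF assms] by simp

text \<open>
  Taking adjoints replaces \<open>\<gamma>(t)\<close> by its inverse \<open>\<gamma>(-t)\<close>, which only permutes the summands.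
\<close>

lemma I_op_hermitian:
  assumes u: "unitary_rep G \<rho>" and \<gamma>: "\<gamma> \<in> nontriv_homs n G" and n: "n > 0"
  shows "mat_adjoint (I_op G n \<rho> \<gamma>) = I_op G n \<rho> \<gamma>"
proof -
  let ?d = "rep_dim G \<rho>" and ?Z = "integer_mod_group n"
  have r: "representation G \<rho>" using u by (simp add: unitary_rep_def)
  note closed = nontriv_hom_closed[OF \<gamma>]
  interpret Z: group ?Z by simp
  have "mat_adjoint (I_op G n \<rho> \<gamma>) = mat_sum ?d ?d (\<lambda>t. mat_adjoint (\<rho> (\<gamma> t))) (carrier ?Z)"
    unfolding I_op_eq_mat_sum[OF r \<gamma> n] using r closed
    by (intro eq_matI) (auto simp: cnj_sum intro!: sum.cong)
  also have "\<dots> = mat_sum ?d ?d (\<lambda>t. \<rho> (\<gamma> (inv\<^bsub>?Z\<^esub> t))) (carrier ?Z)"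
    using unitary_rep_adjoint[OF u closed] nontriv_hom_inv[OF \<gamma>] by (intro mat_sum_cong) metis
  also have "\<dots> = I_op G n \<rho> \<gamma>"
    unfolding I_op_eq_mat_sum[OF r \<gamma> n] by (rule mat_sum_reindex[OF Z.inv_bij])
  finally show ?thesis .
qed

text \<open>
  Substituting \<open>y = x \<gamma>(t)\<close> turns \<open>f(x \<gamma>(t)) \<rho>(x)\<close> into \<open>f(y) \<rho>(y \<gamma>(-t))\<close>; the sign of \<open>t\<close> is
  absorbed by summing over the whole cyclic group.
\<close>

lemma fourier_radon:
  assumes fin: "finite (carrier G)" and r: "representation G \<rho>"
    and \<gamma>: "\<gamma> \<in> nontriv_homs n G" and n: "n > 0"
  shows "fourier G (\<lambda>x. radon G n f x \<gamma>) \<rho> = fourier G f \<rho> * I_op G n \<rho> \<gamma>"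
proof -
  let ?d = "rep_dim G \<rho>" and ?Z = "integer_mod_group n"
  note closed = nontriv_hom_closed[OF \<gamma>]
  interpret Z: group ?Z by simp
  note rc = rep_carrier[OF r]
  show ?thesis
  proof (rule eq_matI)
    fix a b assume "a < dim_row (fourier G f \<rho> * I_op G n \<rho> \<gamma>)" "b < dim_col (fourier G f \<rho> * I_op G n \<rho> \<gamma>)"
    then have ab: "a < ?d" "b < ?d"
      using I_op_carrier[OF r \<gamma> n] unfolding fourier_eq_mat_sum[OF fin r] by auto
    define \<phi> where "\<phi> t = (\<Sum>x\<in>carrier G. f x * \<rho> (x \<otimes> \<gamma> t) $$ (a, b))" for t
    have step: "(\<Sum>x\<in>carrier G. f (x \<otimes> \<gamma> t) * \<rho> x $$ (a, b)) = \<phi> (inv\<^bsub>?Z\<^esub> t)"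
      if t: "t \<in> carrier ?Z" for t
    proof -
      have "(\<Sum>x\<in>carrier G. f (x \<otimes> \<gamma> t) * \<rho> x $$ (a, b)) =
          (\<Sum>x\<in>carrier G. f (x \<otimes> \<gamma> t) * \<rho> ((x \<otimes> \<gamma> t) \<otimes> inv (\<gamma> t)) $$ (a, b))"
        using closed[OF t] by (intro sum.cong) (auto simp: m_assoc)
      also have "\<dots> = (\<Sum>y\<in>carrier G. f y * \<rho> (y \<otimes> inv (\<gamma> t)) $$ (a, b))"
        by (rule sum.reindex_bij_betw[OF right_mult_bij[OF closed[OF t]]])
      finally show ?thesis unfolding \<phi>_def nontriv_hom_inv[OF \<gamma> t] .
    qed
    have "fourier G (\<lambda>x. radon G n f x \<gamma>) \<rho> $$ (a, b) =
        (\<Sum>x\<in>carrier G. \<Sum>t\<in>carrier ?Z. f (x \<otimes> \<gamma> t) * \<rho> x $$ (a, b))"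
      unfolding fourier_eq_mat_sum[OF fin r] radon_def using ab r by (simp add: sum_distrib_right)
    also have "\<dots> = (\<Sum>t\<in>carrier ?Z. \<Sum>x\<in>carrier G. f (x \<otimes> \<gamma> t) * \<rho> x $$ (a, b))"
      by (rule sum.swap)
    also have "\<dots> = (\<Sum>t\<in>carrier ?Z. \<phi> (inv\<^bsub>?Z\<^esub> t))" by (intro sum.cong step refl)
    also have "\<dots> = (\<Sum>t\<in>carrier ?Z. \<phi> t)" by (rule sum.reindex_bij_betw[OF Z.inv_bij])
    also have "\<dots> = (\<Sum>x\<in>carrier G. f x * (\<Sum>t\<in>carrier ?Z. \<rho> (x \<otimes> \<gamma> t) $$ (a, b)))"
      unfolding \<phi>_def sum_distrib_left by (rule sum.swap)
    also have "\<dots> = (\<Sum>x\<in>carrier G. (f x \<cdot>\<^sub>m \<rho> x * I_op G n \<rho> \<gamma>) $$ (a, b))"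
    proof (intro sum.cong refl)
      fix x assume x: "x \<in> carrier G"
      have "\<rho> x * I_op G n \<rho> \<gamma> = mat_sum ?d ?d (\<lambda>t. \<rho> x * \<rho> (\<gamma> t)) (carrier ?Z)"
        unfolding I_op_eq_mat_sum[OF r \<gamma> n] using rc closed x by (intro mult_mat_sum) auto
      also have "\<dots> = mat_sum ?d ?d (\<lambda>t. \<rho> (x \<otimes> \<gamma> t)) (carrier ?Z)"
        using rep_mult[OF r x closed] by (intro mat_sum_cong) simp
      finally have "\<rho> x * I_op G n \<rho> \<gamma> = mat_sum ?d ?d (\<lambda>t. \<rho> (x \<otimes> \<gamma> t)) (carrier ?Z)" .
      then show "f x * (\<Sum>t\<in>carrier ?Z. \<rho> (x \<otimes> \<gamma> t) $$ (a, b)) = (f x \<cdot>\<^sub>m \<rho> x * I_op G n \<rho> \<gamma>) $$ (a, b)"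
        using mult_smult_assoc_mat[OF rc[OF x] I_op_carrier[OF r \<gamma> n]] ab by simp
    qed
    also have "\<dots> = (fourier G f \<rho> * I_op G n \<rho> \<gamma>) $$ (a, b)"
      unfolding fourier_eq_mat_sum[OF fin r]
      using ab rc by (subst mat_sum_mult[OF I_op_carrier[OF r \<gamma> n]]) auto
    finally show "fourier G (\<lambda>x. radon G n f x \<gamma>) \<rho> $$ (a, b) = (fourier G f \<rho> * I_op G n \<rho> \<gamma>) $$ (a, b)" .
  qed (use I_op_carrier[OF r \<gamma> n] in \<open>auto simp: fourier_eq_mat_sum[OF fin r]\<close>)
qed

text \<open>
  The exponent \<open>k\<close> is chosen so that \<open>y\<^sup>k\<close> has prime order \<open>p\<close>. That the homomorphism consists of
  powers of \<open>y\<close> matters for both uses: its values fix whatever \<open>y\<close> fixes, and they lie in any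
  subgroup containing \<open>y\<close>.
\<close>

lemma power_prime_hom:
  assumes fin: "finite (carrier G)" and y: "y \<in> carrier G" "y \<noteq> \<one>"
  obtains p :: nat and k :: nat where "Factorial_Ring.prime p" "p dvd Coset.order G"
    "(\<lambda>t::int. (y [^] k) [^] t) \<in> nontriv_homs p G"
proof -
  have "ord y \<noteq> 1" using y ord_eq_1 by blast
  then obtain p where p: "Factorial_Ring.prime p" "p dvd ord y"
    using prime_factor_nat by blast
  define k where "k = ord y div p"
  have pos: "ord y > 0" using ord_ge_1[OF fin y(1)] by simp
  have "p > 1" using p(1) prime_gt_1_nat by auto
  have k: "ord y = k * p" "k dvd ord y" "k \<noteq> 0" using p pos unfolding k_def by auto
  define z where "z = y [^] k"
  have z: "z \<in> carrier G" "ord z = p"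
    using ord_pow[OF y(1) k(2,3)] k y(1) unfolding z_def by auto
  have "z \<noteq> \<one>" using z \<open>p > 1\<close> by (metis less_not_refl ord_eq_1)
  have mod: "z [^] (m mod int p) = z [^] m" for m :: int
    using int_pow_eq[OF z(1), of "m mod int p" m] z(2)
    by (simp add: minus_mod_eq_mult_div)
  have "(\<lambda>t::int. z [^] t) \<in> hom (integer_mod_group p) G"
    using z(1) by (intro homI) (simp_all add: mod int_pow_mult)
  moreover have "\<exists>t\<in>carrier (integer_mod_group p). z [^] t \<noteq> \<one>"
    using \<open>z \<noteq> \<one>\<close> z(1) \<open>p > 1\<close> by (intro bexI[of _ 1]) auto
  ultimately have "(\<lambda>t::int. z [^] t) \<in> nontriv_homs p G" by (simp add: nontriv_homs_def)
  moreover have "p dvd Coset.order G" using p(2) ord_dvd_group_order[OF y(1)] dvd_trans by blast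
  ultimately show ?thesis using that p(1) unfolding z_def by blast
qed

text \<open>
  Instead of decomposing the image of \<open>\<gamma>\<close> into cosets of a subgroup of prime order, the sum is
  averaged: translating \<open>t\<close> by a preimage of \<open>\<delta>(j)\<close> leaves the sum over \<open>t\<close> unchanged, so
  \<open>p R\<^sub>n f(x, \<gamma>)\<close> is the sum over \<open>t\<close> of the vanishing values \<open>R\<^sub>p f(x \<gamma>(t), \<delta>)\<close>.
\<close>

lemma radon_zero_prime:
  assumes fin: "finite (carrier G)"
    and zero: "\<And>p x \<gamma>. Factorial_Ring.prime p \<Longrightarrow> p dvd Coset.order G \<Longrightarrow> \<gamma> \<in> nontriv_homs p G
      \<Longrightarrow> x \<in> carrier G \<Longrightarrow> radon G p f x \<gamma> = 0"
  shows "radon_zero G f"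
  unfolding radon_zero_def
proof (intro allI impI ballI)
  fix n x \<gamma> assume n: "(2::nat) \<le> n" and x: "x \<in> carrier G" and \<gamma>: "\<gamma> \<in> nontriv_homs n G"
  let ?Z = "integer_mod_group n"
  interpret Z: group ?Z by simp
  note closed = nontriv_hom_closed[OF \<gamma>]
  obtain s where s: "s \<in> carrier ?Z" "\<gamma> s \<noteq> \<one>" using \<gamma> by (auto simp: nontriv_homs_def)
  obtain p k where p: "Factorial_Ring.prime p" "p dvd Coset.order G"
    and \<delta>: "(\<lambda>t::int. (\<gamma> s [^] (k::nat)) [^] t) \<in> nontriv_homs p G"
    by (rule power_prime_hom[OF fin closed[OF s(1)] s(2)])
  define \<delta>' where "\<delta>' = (\<lambda>t::int. (\<gamma> s [^] k) [^] t)"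
  let ?P = "integer_mod_group p"
  have hom: "group_hom ?Z G \<gamma>"
    using \<gamma> is_group by (auto simp: group_hom_def group_hom_axioms_def nontriv_homs_def)
  have shift: "(\<Sum>t\<in>carrier ?Z. f (x \<otimes> \<gamma> t)) = (\<Sum>t\<in>carrier ?Z. f (x \<otimes> \<gamma> t \<otimes> \<delta>' j))"
    for j :: int
  proof -
    \<comment> \<open>A preimage of \<open>\<delta>(j)\<close> under \<open>\<gamma>\<close>.\<close>
    define u where "u = (s [^]\<^bsub>?Z\<^esub> k) [^]\<^bsub>?Z\<^esub> j"
    have u: "u \<in> carrier ?Z" unfolding u_def using s(1) by (intro Z.int_pow_closed Z.nat_pow_closed)
    have "\<gamma> u = \<delta>' j"
      unfolding u_def \<delta>'_def using group_hom.hom_nat_pow[OF hom s(1)]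
        group_hom.hom_int_pow[OF hom Z.nat_pow_closed[OF s(1)]] by metis
    moreover from this have "\<delta>' j \<in> carrier G" using closed[OF u] by simp
    ultimately have "(\<Sum>t\<in>carrier ?Z. f (x \<otimes> \<gamma> t \<otimes> \<delta>' j)) =
        (\<Sum>t\<in>carrier ?Z. f (x \<otimes> \<gamma> (t \<otimes>\<^bsub>?Z\<^esub> u)))"
      using nontriv_hom_mult[OF \<gamma> _ u] closed u x by (intro sum.cong) (auto simp: m_assoc)
    also have "\<dots> = (\<Sum>t\<in>carrier ?Z. f (x \<otimes> \<gamma> t))"
      by (rule sum.reindex_bij_betw[OF Z.right_mult_bij[OF u]])
    finally show ?thesis ..
  qed
  have "of_nat (card (carrier ?P)) * radon G n f x \<gamma> =
      (\<Sum>j\<in>carrier ?P. \<Sum>t\<in>carrier ?Z. f (x \<otimes> \<gamma> t \<otimes> \<delta>' j))"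
    unfolding radon_def shift[symmetric] by simp
  also have "\<dots> = (\<Sum>t\<in>carrier ?Z. radon G p f (x \<otimes> \<gamma> t) \<delta>')"
    unfolding radon_def by (rule sum.swap)
  also have "\<dots> = 0"
    using zero[OF p \<delta>] closed x unfolding \<delta>'_def by (intro sum.neutral) auto
  finally show "radon G n f x \<gamma> = 0"
    using p(1) by (simp add: carrier_integer_mod_group prime_gt_0_nat split: if_splits)
qed

section \<open>Kernels, fixed points and irreducibility\<close>

text \<open>
  Since \<open>I\<close> is Hermitian, \<open>I\<close> applied to the conjugate transpose of a row \<open>r\<close> is the conjugate
  transpose of \<open>r I\<close>.
\<close>

lemma K_star_row_iff:
  assumes u: "unitary_rep G \<rho>" and \<gamma>: "\<gamma> \<in> nontriv_homs n G" and n: "n > 0"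
    and M: "M \<in> carrier_mat (rep_dim G \<rho>) (rep_dim G \<rho>)"
  shows "(\<forall>i<rep_dim G \<rho>. conjugate (row M i) \<in> mat_kernel (I_op G n \<rho> \<gamma>)) \<longleftrightarrow>
    M * I_op G n \<rho> \<gamma> = 0\<^sub>m (rep_dim G \<rho>) (rep_dim G \<rho>)"
proof -
  let ?d = "rep_dim G \<rho>"
  define I where "I = I_op G n \<rho> \<gamma>"
  have r: "representation G \<rho>" using u by (simp add: unitary_rep_def)
  have I: "I \<in> carrier_mat ?d ?d" unfolding I_def by (rule I_op_carrier[OF r \<gamma> n])
  have herm: "cnj (I $$ (j, l)) = I $$ (l, j)" if "j < ?d" "l < ?d" for j l
    using arg_cong[OF I_op_hermitian[OF u \<gamma> n], of "\<lambda>A. A $$ (l, j)"] I that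
    unfolding I_def[symmetric] by simp
  have entry: "(I *\<^sub>v conjugate (row M i)) $ j = cnj ((M * I) $$ (i, j))" if "i < ?d" "j < ?d" for i j
  proof -
    have "cnj ((M * I) $$ (i, j)) = (\<Sum>l<?d. cnj (M $$ (i, l)) * cnj (I $$ (l, j)))"
      using that M I by (simp add: scalar_prod_def atLeast0LessThan)
    also have "\<dots> = (\<Sum>l<?d. I $$ (j, l) * cnj (M $$ (i, l)))"
      using herm that by (intro sum.cong) auto
    also have "\<dots> = (I *\<^sub>v conjugate (row M i)) $ j"
      using that M I by (simp add: scalar_prod_def atLeast0LessThan)
    finally show ?thesis ..
  qed
  have "conjugate (row M i) \<in> mat_kernel I \<longleftrightarrow> (\<forall>j<?d. (M * I) $$ (i, j) = 0)" if i: "i < ?d" for i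
  proof -
    have "conjugate (row M i) \<in> mat_kernel I \<longleftrightarrow> I *\<^sub>v conjugate (row M i) = 0\<^sub>v ?d"
      using I M carrier_vec_conjugate[OF row_carrier_vec[OF i M]] by (auto simp: mat_kernel_def)
    also have "\<dots> \<longleftrightarrow> (\<forall>j<?d. (I *\<^sub>v conjugate (row M i)) $ j = 0)"
      using I by (auto simp: vec_eq_iff)
    finally show ?thesis using entry[OF i] by simp
  qed
  moreover have "M * I = 0\<^sub>m ?d ?d \<longleftrightarrow> (\<forall>i<?d. \<forall>j<?d. (M * I) $$ (i, j) = 0)"
    using M I by (auto simp: mat_eq_iff)
  ultimately show ?thesis unfolding I_def by blast
qed

lemma K_star_iff:
  assumes fin: "finite (carrier G)" and u: "unitary_rep G \<rho>"
  shows "fourier G f \<rho> \<in> K_star G \<rho> \<longleftrightarrow>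
    (\<forall>p. Factorial_Ring.prime p \<and> p dvd Coset.order G \<longrightarrow> (\<forall>\<gamma>\<in>nontriv_homs p G.
      fourier G (\<lambda>x. radon G p f x \<gamma>) \<rho> = 0\<^sub>m (rep_dim G \<rho>) (rep_dim G \<rho>)))"
proof -
  have r: "representation G \<rho>" using u by (simp add: unitary_rep_def)
  have F: "fourier G f \<rho> \<in> carrier_mat (rep_dim G \<rho>) (rep_dim G \<rho>)"
    unfolding fourier_eq_mat_sum[OF fin r] by simp
  have "fourier G f \<rho> \<in> K_star G \<rho> \<longleftrightarrow>
    (\<forall>p. Factorial_Ring.prime p \<and> p dvd Coset.order G \<longrightarrow> (\<forall>\<gamma>\<in>nontriv_homs p G.
      \<forall>i<rep_dim G \<rho>. conjugate (row (fourier G f \<rho>) i) \<in> mat_kernel (I_op G p \<rho> \<gamma>)))"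
    using F unfolding K_star_def k_space_def by auto
  moreover have "(\<forall>i<rep_dim G \<rho>. conjugate (row (fourier G f \<rho>) i) \<in> mat_kernel (I_op G p \<rho> \<gamma>)) \<longleftrightarrow>
      fourier G (\<lambda>x. radon G p f x \<gamma>) \<rho> = 0\<^sub>m (rep_dim G \<rho>) (rep_dim G \<rho>)"
    if "Factorial_Ring.prime p" "\<gamma> \<in> nontriv_homs p G" for p \<gamma>
    using K_star_row_iff[OF u that(2) prime_gt_0_nat[OF that(1)] F]
      fourier_radon[OF fin r that(2) prime_gt_0_nat[OF that(1)], of f] by simp
  ultimately show ?thesis by blast
qed

lemma I_op_stabilizer:
  assumes r: "representation G \<rho>" and v: "v \<in> carrier_vec (rep_dim G \<rho>)"
    and x: "x \<in> carrier G" "\<rho> x *\<^sub>v v = v"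
    and \<gamma>: "(\<lambda>t::int. (x [^] (k::nat)) [^] t) \<in> nontriv_homs p G" and p: "p > 0"
  shows "I_op G p \<rho> (\<lambda>t. (x [^] k) [^] t) *\<^sub>v v = of_nat p \<cdot>\<^sub>v v"
proof -
  let ?d = "rep_dim G \<rho>"
  have pow: "\<rho> (x [^] m) *\<^sub>v v = v" for m :: nat
  proof (induction m)
    case 0
    then show ?case using rep_one[OF r] v by simp
  next
    case (Suc m)
    have "\<rho> (x [^] Suc m) *\<^sub>v v = \<rho> (x [^] m) *\<^sub>v (\<rho> x *\<^sub>v v)"
      using rep_mult[OF r _ x(1)] x(1) v
        assoc_mult_mat_vec[OF rep_carrier[OF r] rep_carrier[OF r x(1)] v] by simp
    then show ?case using x(2) Suc by simp
  qed
  have fixed: "\<rho> ((x [^] k) [^] t) *\<^sub>v v = v" if t: "t \<in> carrier (integer_mod_group p)" for t :: int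
  proof -
    obtain m where "t = int m"
      using t p by (auto simp: carrier_integer_mod_group elim: nonneg_int_cases)
    then show ?thesis using pow[of "k * m"] x(1) by (simp add: int_pow_int nat_pow_pow)
  qed
  show ?thesis
  proof (rule eq_vecI)
    fix i assume "i < dim_vec (of_nat p \<cdot>\<^sub>v v)"
    then have i: "i < ?d" using v by simp
    have "(I_op G p \<rho> (\<lambda>t. (x [^] k) [^] t) *\<^sub>v v) $ i =
        (\<Sum>t\<in>carrier (integer_mod_group p). (\<rho> ((x [^] k) [^] t) *\<^sub>v v) $ i)"
      unfolding I_op_eq_mat_sum[OF r \<gamma> p] using v i rep_carrier[OF r] x(1)
      by (intro mat_sum_mult_vec_index) auto
    also have "\<dots> = of_nat (card (carrier (integer_mod_group p))) * v $ i"
      using fixed by simp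
    also have "\<dots> = (of_nat p \<cdot>\<^sub>v v) $ i"
      using p i v by (simp add: carrier_integer_mod_group)
    finally show "(I_op G p \<rho> (\<lambda>t. (x [^] k) [^] t) *\<^sub>v v) $ i = (of_nat p \<cdot>\<^sub>v v) $ i" .
  qed (use I_op_carrier[OF r \<gamma> p] v in auto)
qed

lemma rep_mult_I_op:
  assumes r: "representation G \<rho>" and \<gamma>: "\<gamma> \<in> nontriv_homs n G" and n: "n > 0"
    and s: "s \<in> carrier (integer_mod_group n)"
  shows "\<rho> (\<gamma> s) * I_op G n \<rho> \<gamma> = I_op G n \<rho> \<gamma>"
proof -
  let ?d = "rep_dim G \<rho>" and ?Z = "integer_mod_group n"
  interpret Z: group ?Z by simp
  note closed = nontriv_hom_closed[OF \<gamma>]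
  have "\<rho> (\<gamma> s) * I_op G n \<rho> \<gamma> = mat_sum ?d ?d (\<lambda>t. \<rho> (\<gamma> s) * \<rho> (\<gamma> t)) (carrier ?Z)"
    unfolding I_op_eq_mat_sum[OF r \<gamma> n] using rep_carrier[OF r] closed s by (intro mult_mat_sum) auto
  also have "\<dots> = mat_sum ?d ?d (\<lambda>t. \<rho> (\<gamma> (s \<otimes>\<^bsub>?Z\<^esub> t))) (carrier ?Z)"
    using rep_mult[OF r closed[OF s] closed] nontriv_hom_mult[OF \<gamma> s] by (intro mat_sum_cong) metis
  also have "\<dots> = I_op G n \<rho> \<gamma>"
    unfolding I_op_eq_mat_sum[OF r \<gamma> n] by (rule mat_sum_reindex[OF Z.left_mult_bij[OF s]])
  finally show ?thesis .
qed

text \<open>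
  If \<open>I(\<rho>, \<gamma>)\<close> is always zero and \<open>x \<noteq> 1\<close> fixes \<open>v\<close>, some power of \<open>x\<close> has prime order \<open>p\<close> and also
  fixes \<open>v\<close>, so the corresponding \<open>I(\<rho>, \<gamma>)\<close> sends \<open>v\<close> to \<open>p v\<close>, and \<open>v = 0\<close>. Conversely the range of
  \<open>I(\<rho>, \<gamma>)\<close> is fixed by every \<open>\<gamma>(s)\<close>, one of which is not the identity; so it is zero if \<open>\<rho>\<close> has
  no nonzero fixed points.
\<close>

lemma k_space_eq_carrier_iff:
  assumes fin: "finite (carrier G)" and r: "representation G \<rho>"
  shows "k_space G \<rho> = carrier_vec (rep_dim G \<rho>) \<longleftrightarrow> F_set G \<rho> \<subseteq> {0\<^sub>v (rep_dim G \<rho>)}"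
proof
  let ?d = "rep_dim G \<rho>"
  assume k: "k_space G \<rho> = carrier_vec ?d"
  show "F_set G \<rho> \<subseteq> {0\<^sub>v ?d}"
  proof
    fix v assume "v \<in> F_set G \<rho>"
    then obtain x where v: "v \<in> carrier_vec ?d" and x: "x \<in> carrier G" "x \<noteq> \<one>" "\<rho> x *\<^sub>v v = v"
      unfolding F_set_def by auto
    obtain p m where p: "Factorial_Ring.prime p" "p dvd Coset.order G"
      and \<gamma>: "(\<lambda>t::int. (x [^] (m::nat)) [^] t) \<in> nontriv_homs p G"
      by (rule power_prime_hom[OF fin x(1,2)])
    have p0: "p > 0" using p(1) prime_gt_0_nat by blast
    have "v \<in> k_space G \<rho>" using v k by simp
    then have "I_op G p \<rho> (\<lambda>t. (x [^] m) [^] t) *\<^sub>v v = 0\<^sub>v ?d"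
      using p \<gamma> I_op_carrier[OF r \<gamma> p0] unfolding k_space_def mat_kernel_def by auto
    then have zero: "of_nat p \<cdot>\<^sub>v v = 0\<^sub>v ?d" using I_op_stabilizer[OF r v x(1,3) \<gamma> p0] by simp
    have "v $ i = 0" if "i < ?d" for i
      using arg_cong[OF zero, of "\<lambda>w. w $ i"] that v p0 by simp
    then have "v = 0\<^sub>v ?d" using v by (intro eq_vecI) auto
    then show "v \<in> {0\<^sub>v ?d}" by simp
  qed
next
  let ?d = "rep_dim G \<rho>"
  assume F: "F_set G \<rho> \<subseteq> {0\<^sub>v ?d}"
  have "v \<in> mat_kernel (I_op G p \<rho> \<gamma>)"
    if v: "v \<in> carrier_vec ?d" and p: "Factorial_Ring.prime p" and \<gamma>: "\<gamma> \<in> nontriv_homs p G" for v p \<gamma>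
  proof -
    have p0: "p > 0" using p prime_gt_0_nat by blast
    note I = I_op_carrier[OF r \<gamma> p0]
    obtain s where s: "s \<in> carrier (integer_mod_group p)" "\<gamma> s \<noteq> \<one>"
      using \<gamma> by (auto simp: nontriv_homs_def)
    have g: "\<gamma> s \<in> carrier G" by (rule nontriv_hom_closed[OF \<gamma> s(1)])
    have "\<rho> (\<gamma> s) *\<^sub>v (I_op G p \<rho> \<gamma> *\<^sub>v v) = I_op G p \<rho> \<gamma> *\<^sub>v v"
      using assoc_mult_mat_vec[OF rep_carrier[OF r g] I v] rep_mult_I_op[OF r \<gamma> p0 s(1)] by simp
    then have "I_op G p \<rho> \<gamma> *\<^sub>v v \<in> F_set G \<rho>"
      unfolding F_set_def using I v g s(2) by auto
    then show ?thesis using F I v by (auto simp: mat_kernel_def)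
  qed
  then show "k_space G \<rho> = carrier_vec ?d" unfolding k_space_def by auto
qed

lemma k_space_subspace:
  assumes r: "representation G \<rho>"
  shows "VectorSpace.subspace class_ring (k_space G \<rho>) (module_vec TYPE(complex) (rep_dim G \<rho>))"
proof -
  let ?d = "rep_dim G \<rho>"
  let ?P = "\<lambda>p \<gamma>. Factorial_Ring.prime p \<and> p dvd Coset.order G \<and> \<gamma> \<in> nontriv_homs p G"
  have I: "I_op G p \<rho> \<gamma> \<in> carrier_mat ?d ?d" if "?P p \<gamma>" for p \<gamma>
    using I_op_carrier[OF r, of \<gamma> p] prime_gt_0_nat[of p] that by blast
  have ker: "mat_kernel (I_op G p \<rho> \<gamma>) = {v \<in> carrier_vec ?d. I_op G p \<rho> \<gamma> *\<^sub>v v = 0\<^sub>v ?d}"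
    if "?P p \<gamma>" for p \<gamma>
    using I[OF that] by (simp add: mat_kernel_def)
  have "k_space G \<rho> = {v \<in> carrier_vec ?d. \<forall>p \<gamma>. ?P p \<gamma> \<longrightarrow> v \<in> mat_kernel (I_op G p \<rho> \<gamma>)}"
    unfolding k_space_def by blast
  also have "\<dots> = {v \<in> carrier_vec ?d. \<forall>p \<gamma>. ?P p \<gamma> \<longrightarrow> I_op G p \<rho> \<gamma> *\<^sub>v v = 0\<^sub>v ?d}"
    using ker by blast
  finally have k: "k_space G \<rho> = \<dots>" .
  have zero: "I_op G p \<rho> \<gamma> *\<^sub>v 0\<^sub>v ?d = 0\<^sub>v ?d" if "?P p \<gamma>" for p \<gamma>
    using I[OF that] by (intro eq_vecI) auto
  have add: "I_op G p \<rho> \<gamma> *\<^sub>v (v + w) = 0\<^sub>v ?d"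
    if "?P p \<gamma>" "v \<in> k_space G \<rho>" "w \<in> k_space G \<rho>" for p \<gamma> v w
    using mult_add_distrib_mat_vec[OF I[OF that(1)], of v w] that unfolding k by simp
  have smult: "I_op G p \<rho> \<gamma> *\<^sub>v (c \<cdot>\<^sub>v v) = 0\<^sub>v ?d"
    if "?P p \<gamma>" "v \<in> k_space G \<rho>" for p \<gamma> v c
  proof -
    have "c \<cdot>\<^sub>v 0\<^sub>v ?d = 0\<^sub>v ?d" by (intro eq_vecI) auto
    then show ?thesis using mult_mat_vec[OF I[OF that(1)], of v c] that unfolding k by simp
  qed
  show ?thesis
    unfolding subspace_iff
  proof (intro conjI ballI allI)
    show "k_space G \<rho> \<subseteq> carrier_vec ?d" unfolding k by blast
    show "0\<^sub>v ?d \<in> k_space G \<rho>" unfolding k using zero by simp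
    show "v + w \<in> k_space G \<rho>" if "v \<in> k_space G \<rho>" "w \<in> k_space G \<rho>" for v w
      using add[OF _ that] that unfolding k by simp
    show "c \<cdot>\<^sub>v v \<in> k_space G \<rho>" if "v \<in> k_space G \<rho>" for c v
      using smult[OF _ that] that unfolding k by simp
  qed
qed

lemma conjugate_hom:
  assumes \<gamma>: "\<gamma> \<in> nontriv_homs n G" and x: "x \<in> carrier G"
  shows "(\<lambda>t. inv x \<otimes> \<gamma> t \<otimes> x) \<in> nontriv_homs n G"
proof -
  note closed = nontriv_hom_closed[OF \<gamma>]
  obtain s where s: "s \<in> carrier (integer_mod_group n)" "\<gamma> s \<noteq> \<one>"
    using \<gamma> by (auto simp: nontriv_homs_def)
  have cancel: "a \<otimes> x \<otimes> (inv x \<otimes> b) = a \<otimes> b" if "a \<in> carrier G" "b \<in> carrier G" for a b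
    using that x by (simp add: m_assoc) (simp add: m_assoc[symmetric])
  have "(\<lambda>t. inv x \<otimes> \<gamma> t \<otimes> x) \<in> hom (integer_mod_group n) G"
  proof (rule homI)
    fix a b assume ab: "a \<in> carrier (integer_mod_group n)" "b \<in> carrier (integer_mod_group n)"
    show "inv x \<otimes> \<gamma> (a \<otimes>\<^bsub>integer_mod_group n\<^esub> b) \<otimes> x = inv x \<otimes> \<gamma> a \<otimes> x \<otimes> (inv x \<otimes> \<gamma> b \<otimes> x)"
      using nontriv_hom_mult[OF \<gamma> ab] cancel[of "inv x \<otimes> \<gamma> a" "\<gamma> b \<otimes> x"] closed[OF ab(1)] closed[OF ab(2)] x
      by (simp add: m_assoc)
  qed (use closed x in auto)
  moreover have "inv x \<otimes> \<gamma> s \<otimes> x \<noteq> \<one>"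
  proof
    assume "inv x \<otimes> \<gamma> s \<otimes> x = \<one>"
    then have "\<gamma> s = x \<otimes> \<one> \<otimes> inv x"
      using closed[OF s(1)] x by (metis inv_closed inv_solve_left inv_solve_right m_assoc m_closed one_closed)
    then show False using s(2) x by simp
  qed
  ultimately show ?thesis using s(1) unfolding nontriv_homs_def by blast
qed

text \<open>
  Moving \<open>\<rho>(x)\<close> past \<open>I(\<rho>, \<gamma>)\<close> replaces \<open>\<gamma>\<close> by its conjugate under \<open>x\<close>, which is again among the
  homomorphisms defining \<open>k(\<rho>)\<close>.
\<close>

lemma k_space_invariant:
  assumes r: "representation G \<rho>" and x: "x \<in> carrier G" and w: "w \<in> k_space G \<rho>"
  shows "\<rho> x *\<^sub>v w \<in> k_space G \<rho>"
proof -
  let ?d = "rep_dim G \<rho>"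
  have wc: "w \<in> carrier_vec ?d" using w by (simp add: k_space_def)
  have "\<rho> x *\<^sub>v w \<in> mat_kernel (I_op G p \<rho> \<gamma>)"
    if p: "Factorial_Ring.prime p" "p dvd Coset.order G" and \<gamma>: "\<gamma> \<in> nontriv_homs p G" for p \<gamma>
  proof -
    let ?Z = "integer_mod_group p"
    define \<delta> where "\<delta> = (\<lambda>t. inv x \<otimes> \<gamma> t \<otimes> x)"
    have \<delta>: "\<delta> \<in> nontriv_homs p G" unfolding \<delta>_def by (rule conjugate_hom[OF \<gamma> x])
    have p0: "p > 0" using p(1) prime_gt_0_nat by blast
    note closed = nontriv_hom_closed[OF \<gamma>]
    note rc = rep_carrier[OF r]
    have "I_op G p \<rho> \<gamma> * \<rho> x = mat_sum ?d ?d (\<lambda>t. \<rho> (\<gamma> t) * \<rho> x) (carrier ?Z)"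
      unfolding I_op_eq_mat_sum[OF r \<gamma> p0] using rc closed x by (intro mat_sum_mult) auto
    also have "\<dots> = mat_sum ?d ?d (\<lambda>t. \<rho> x * \<rho> (\<delta> t)) (carrier ?Z)"
    proof (rule mat_sum_cong)
      fix t assume t: "t \<in> carrier ?Z"
      have "\<gamma> t \<otimes> x = x \<otimes> \<delta> t"
        unfolding \<delta>_def using closed[OF t] x by (simp add: m_assoc[symmetric])
      then show "\<rho> (\<gamma> t) * \<rho> x = \<rho> x * \<rho> (\<delta> t)"
        using rep_mult[OF r closed[OF t] x] rep_mult[OF r x nontriv_hom_closed[OF \<delta> t]] by simp
    qed
    also have "\<dots> = \<rho> x * I_op G p \<rho> \<delta>"
      unfolding I_op_eq_mat_sum[OF r \<delta> p0] using rc nontriv_hom_closed[OF \<delta>] x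
      by (intro mult_mat_sum[symmetric]) auto
    finally have eq: "I_op G p \<rho> \<gamma> * \<rho> x = \<rho> x * I_op G p \<rho> \<delta>" .
    have "I_op G p \<rho> \<delta> *\<^sub>v w = 0\<^sub>v ?d"
      using w p \<delta> I_op_carrier[OF r \<delta> p0] unfolding k_space_def mat_kernel_def by auto
    moreover have "I_op G p \<rho> \<gamma> *\<^sub>v (\<rho> x *\<^sub>v w) = \<rho> x *\<^sub>v (I_op G p \<rho> \<delta> *\<^sub>v w)"
      using assoc_mult_mat_vec[OF I_op_carrier[OF r \<gamma> p0] rc[OF x] wc]
        assoc_mult_mat_vec[OF rc[OF x] I_op_carrier[OF r \<delta> p0] wc] eq by simp
    moreover have "\<rho> x *\<^sub>v 0\<^sub>v ?d = 0\<^sub>v ?d" using rc[OF x] by (intro eq_vecI) auto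
    ultimately show ?thesis
      using mat_kernelI[OF I_op_carrier[OF r \<gamma> p0], of "\<rho> x *\<^sub>v w"] rc[OF x] wc by auto
  qed
  then show ?thesis using rep_carrier[OF r x] wc unfolding k_space_def by auto
qed

lemma k_space_irreducible:
  assumes "irreducible_rep G \<rho>"
  shows "k_space G \<rho> = {0\<^sub>v (rep_dim G \<rho>)} \<or> k_space G \<rho> = carrier_vec (rep_dim G \<rho>)"
  using assms k_space_subspace[of \<rho>] k_space_invariant[of \<rho>] unfolding irreducible_rep_def by blast

end

section \<open>The characterisation of the kernel of the Radon transform\<close>

theorem theorem6p8:
  fixes G :: "('a, 'b) monoid_scheme"
    and f :: "'a \<Rightarrow> complex"
    and Ghat :: "('a \<Rightarrow> complex mat) set"
  assumes "group G" and "finite (carrier G)" and "is_dual G Ghat"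
  shows "(radon_zero G f \<longleftrightarrow> (\<forall>\<rho> \<in> Ghat. fourier G f \<rho> \<in> K_star G \<rho>)) \<and>
         ((\<forall>\<rho> \<in> Ghat. fourier G f \<rho> \<in> K_star G \<rho>) \<longleftrightarrow>
          (\<forall>\<rho> \<in> Ghat - FPF G Ghat. fourier G f \<rho> = 0\<^sub>m (rep_dim G \<rho>) (rep_dim G \<rho>)))"
proof (intro conjI)
  interpret group G by (rule assms(1))
  note fin = assms(2)
  have irr: "irreducible_rep G \<rho>" and u: "unitary_rep G \<rho>" and r: "representation G \<rho>"
    if "\<rho> \<in> Ghat" for \<rho>
    using that assms(3) by (auto simp: is_dual_def unitary_rep_def)
  have F: "fourier G g \<rho> \<in> carrier_mat (rep_dim G \<rho>) (rep_dim G \<rho>)" if "\<rho> \<in> Ghat" for g \<rho>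
    unfolding fourier_eq_mat_sum[OF fin r[OF that]] by simp
  show "radon_zero G f \<longleftrightarrow> (\<forall>\<rho> \<in> Ghat. fourier G f \<rho> \<in> K_star G \<rho>)"
  proof
    assume R: "radon_zero G f"
    show "\<forall>\<rho> \<in> Ghat. fourier G f \<rho> \<in> K_star G \<rho>"
    proof
      fix \<rho> assume \<rho>: "\<rho> \<in> Ghat"
      have "fourier G (\<lambda>x. radon G p f x \<gamma>) \<rho> = 0\<^sub>m (rep_dim G \<rho>) (rep_dim G \<rho>)"
        if "Factorial_Ring.prime p" "\<gamma> \<in> nontriv_homs p G" for p \<gamma>
      proof -
        have "radon G p f x \<gamma> = 0" if "x \<in> carrier G" for x
          using R \<open>x \<in> carrier G\<close> \<open>\<gamma> \<in> nontriv_homs p G\<close> prime_ge_2_nat[OF \<open>Factorial_Ring.prime p\<close>]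
          unfolding radon_zero_def by blast
        then show ?thesis
          unfolding fourier_eq_mat_sum[OF fin r[OF \<rho>]] using r[OF \<rho>]
          by (intro eq_matI) (auto intro!: sum.neutral)
      qed
      then show "fourier G f \<rho> \<in> K_star G \<rho>" using K_star_iff[OF fin u[OF \<rho>]] by blast
    qed
  next
    assume K: "\<forall>\<rho> \<in> Ghat. fourier G f \<rho> \<in> K_star G \<rho>"
    show "radon_zero G f"
    proof (rule radon_zero_prime[OF fin])
      fix p x \<gamma> assume p: "Factorial_Ring.prime p" "p dvd Coset.order G"
        and \<gamma>: "\<gamma> \<in> nontriv_homs p G" and x: "x \<in> carrier G"
      have "fourier G (\<lambda>x. radon G p f x \<gamma>) \<rho> = 0\<^sub>m (rep_dim G \<rho>) (rep_dim G \<rho>)" if "\<rho> \<in> Ghat" for \<rho>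
        using K that K_star_iff[OF fin u[OF that]] p \<gamma> by blast
      then show "radon G p f x \<gamma> = 0" by (rule fourier_injective_dual[OF fin assms(3) _ x])
    qed
  qed
  have fpf: "k_space G \<rho> = carrier_vec (rep_dim G \<rho>) \<longleftrightarrow> \<rho> \<in> FPF G Ghat" if "\<rho> \<in> Ghat" for \<rho>
    using k_space_eq_carrier_iff[OF fin r[OF that]] that by (simp add: FPF_def)
  show "(\<forall>\<rho> \<in> Ghat. fourier G f \<rho> \<in> K_star G \<rho>) \<longleftrightarrow>
      (\<forall>\<rho> \<in> Ghat - FPF G Ghat. fourier G f \<rho> = 0\<^sub>m (rep_dim G \<rho>) (rep_dim G \<rho>))"
  proof -
    have "fourier G f \<rho> \<in> K_star G \<rho> \<longleftrightarrow>
        (\<rho> \<notin> FPF G Ghat \<longrightarrow> fourier G f \<rho> = 0\<^sub>m (rep_dim G \<rho>) (rep_dim G \<rho>))" if \<rho>: "\<rho> \<in> Ghat" for \<rho>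
    proof (cases "\<rho> \<in> FPF G Ghat")
      case True
      then have "k_space G \<rho> = carrier_vec (rep_dim G \<rho>)" using fpf[OF \<rho>] by blast
      then have "fourier G f \<rho> \<in> K_star G \<rho>" using F[OF \<rho>, of f] by (auto simp: K_star_def)
      then show ?thesis using True by simp
    next
      case False
      then have k: "k_space G \<rho> = {0\<^sub>v (rep_dim G \<rho>)}"
        using fpf[OF \<rho>] k_space_irreducible[OF irr[OF \<rho>]] by blast
      have d: "dim_row (fourier G f \<rho>) = rep_dim G \<rho>" "dim_col (fourier G f \<rho>) = rep_dim G \<rho>"
        using F[OF \<rho>, of f] by auto
      have "fourier G f \<rho> \<in> K_star G \<rho> \<longleftrightarrow>
          (\<forall>i<rep_dim G \<rho>. conjugate (row (fourier G f \<rho>) i) = 0\<^sub>v (rep_dim G \<rho>))"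
        unfolding K_star_def k using F[OF \<rho>, of f] by blast
      also have "\<dots> \<longleftrightarrow> (\<forall>i<rep_dim G \<rho>. row (fourier G f \<rho>) i = 0\<^sub>v (rep_dim G \<rho>))"
        by (simp only: conjugate_zero_iff_vec)
      also have "\<dots> \<longleftrightarrow> fourier G f \<rho> = 0\<^sub>m (rep_dim G \<rho>) (rep_dim G \<rho>)"
      proof
        assume rows: "\<forall>i<rep_dim G \<rho>. row (fourier G f \<rho>) i = 0\<^sub>v (rep_dim G \<rho>)"
        show "fourier G f \<rho> = 0\<^sub>m (rep_dim G \<rho>) (rep_dim G \<rho>)"
        proof (rule eq_rowI)
          show "row (fourier G f \<rho>) i = row (0\<^sub>m (rep_dim G \<rho>) (rep_dim G \<rho>)) i"
            if "i < dim_row (0\<^sub>m (rep_dim G \<rho>) (rep_dim G \<rho>) :: complex mat)" for i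
            using rows that by simp
        qed (use d in simp_all)
      qed simp
      finally show ?thesis using False by simp
    qed
    then have "(\<forall>\<rho> \<in> Ghat. fourier G f \<rho> \<in> K_star G \<rho>) \<longleftrightarrow>
        (\<forall>\<rho> \<in> Ghat. \<rho> \<notin> FPF G Ghat \<longrightarrow> fourier G f \<rho> = 0\<^sub>m (rep_dim G \<rho>) (rep_dim G \<rho>))"
      by (rule ball_cong[OF refl])
    then show ?thesis by (simp only: Ball_def Diff_iff imp_conjL)
  qed
qed

end
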